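(* Let $H$ be a complex Hilbert space and let ${\mathcal C}$ be a conjugacy class of rank $k$ operators from ${\mathcal F}_{s}(H)$. Suppose that $\dim H>2k$ and that $f:{\mathcal C}\to{\mathcal C}$ is a bijection preserving the orthogonality relation in both directions, i.e. $$AB=BA=0\;\Longleftrightarrow\; f(A)f(B)=f(B)f(A)=0$$ for all $A,B\in {\mathcal C}$. Then there is a unitary or anti-unitary operator $U$ on $H$ such that $${\rm Im}(f(A))= U({\rm Im}(A))$$ for every $A\in {\mathcal C}$.
   Context: ${\mathcal F}_{s}(H)$ denotes the real vector space of all self-adjoint (bounded) operators of finite rank on $H$; $H$ may be infinite-dimensional. A conjugacy class in ${\mathcal F}_{s}(H)$ is an orbit under the action of unitary operators, i.e. a set of the form $\{UA_0U^{*} : U \text{ unitary on } H\}$ for some $A_0\in{\mathcal F}_s(H)$; all its elements have the same rank. ${\rm Im}(A)$ is the image of $A$. An anti-unitary operator is a conjugate-linear bijection $U:H\to H$ with $\langle Ux,Uy\rangle=\overline{\langle x,y\rangle}$ for all $x,y\in H$. *)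

theory Defs
  imports "HOL-Analysis.Analysis"
begin

(* The library has only real inner product spaces. A complex one carries its underlying real inner
   product space, whose inner product is Re <x,y>; hence the norm is sqrt <x,x>, and positive
   definiteness of cinner is inherited from real_inner. cinner is linear in the first argument. *)
class complex_inner = real_inner +
  fixes scaleC :: "complex \<Rightarrow> 'a \<Rightarrow> 'a"  (infixr "*\<^sub>C" 75)
    and cinner :: "'a \<Rightarrow> 'a \<Rightarrow> complex"
  assumes scaleC_add_right: "a *\<^sub>C (x + y) = a *\<^sub>C x + a *\<^sub>C y"
    and scaleC_add_left: "(a + b) *\<^sub>C x = a *\<^sub>C x + b *\<^sub>C x"
    and scaleC_scaleC: "a *\<^sub>C b *\<^sub>C x = (a * b) *\<^sub>C x"
    and scaleC_of_real: "complex_of_real r *\<^sub>C x = r *\<^sub>R x"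
    and cinner_commute: "cinner x y = cnj (cinner y x)"
    and cinner_add_left: "cinner (x + y) z = cinner x z + cinner y z"
    and cinner_scaleC_left: "cinner (a *\<^sub>C x) y = a * cinner x y"
    and inner_eq_Re_cinner: "inner x y = Re (cinner x y)"

class chilbert_space = complex_inner + complete_space

global_interpretation complex_vector: vector_space "scaleC :: complex \<Rightarrow> 'a \<Rightarrow> 'a::complex_inner"
proof
  show "1 *\<^sub>C x = x" for x :: 'a
    using scaleC_of_real[of 1 x] by simp
qed (simp_all add: scaleC_add_right scaleC_add_left scaleC_scaleC)

lemma cinner_self_eq_norm: "cinner x x = complex_of_real ((norm x)\<^sup>2)"
  using cinner_commute[of x x]
  by (simp add: complex_eq_iff power2_norm_eq_inner inner_eq_Re_cinner)

instantiation complex :: complex_inner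
begin
definition "scaleC = ((*) :: complex \<Rightarrow> complex \<Rightarrow> complex)"
definition "cinner x y = x * cnj y"
instance
  by standard
    (simp_all add: scaleC_complex_def cinner_complex_def algebra_simps scaleR_conv_of_real
      inner_complex_def)
end

instance complex :: chilbert_space ..

instantiation vec :: (complex_inner, finite) complex_inner
begin
definition "scaleC c x = (\<chi> i. c *\<^sub>C (x $ i))"
definition "cinner x y = (\<Sum>i\<in>UNIV. cinner (x $ i) (y $ i))"
instance
proof
  show "cinner x y = cnj (cinner y x)" for x y :: "'a ^ 'b"
    unfolding cinner_vec_def cnj_sum by (rule sum.cong[OF refl cinner_commute])
qed (simp_all add: scaleC_vec_def cinner_vec_def vec_eq_iff scaleC_add_right scaleC_add_left
      scaleC_scaleC scaleC_of_real cinner_add_left cinner_scaleC_left sum.distrib sum_distrib_left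
      inner_vec_def inner_eq_Re_cinner)
end

instance vec :: (chilbert_space, finite) chilbert_space ..

definition cfinite_dim :: "'a::complex_inner set \<Rightarrow> bool" where
  "cfinite_dim S \<longleftrightarrow> (\<exists>B. finite B \<and> S \<subseteq> complex_vector.span B)"

(* complex_vector.dim is 0 on subspaces without a finite basis, so the infinite-dimensional case
   has to be treated separately. *)
definition cdim_greater :: "'a::complex_inner set \<Rightarrow> nat \<Rightarrow> bool" where
  "cdim_greater S n \<longleftrightarrow> (cfinite_dim S \<longrightarrow> complex_vector.dim S > n)"

definition bounded_clinear :: "('a::complex_inner \<Rightarrow> 'a) \<Rightarrow> bool" where
  "bounded_clinear A \<longleftrightarrow> Vector_Spaces.linear scaleC scaleC A \<and> bounded_linear A"

definition is_cadjoint :: "('a::complex_inner \<Rightarrow> 'a) \<Rightarrow> ('a \<Rightarrow> 'a) \<Rightarrow> bool" where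
  "is_cadjoint A B \<longleftrightarrow> (\<forall>x y. cinner (A x) y = cinner x (B y))"

(* The adjoint is unique if it exists, and exists for every bounded operator on a Hilbert space. *)
definition cadjoint :: "('a::complex_inner \<Rightarrow> 'a) \<Rightarrow> 'a \<Rightarrow> 'a" where
  "cadjoint A = (SOME B. is_cadjoint A B)"

definition unitary :: "('a::complex_inner \<Rightarrow> 'a) \<Rightarrow> bool" where
  "unitary U \<longleftrightarrow> Vector_Spaces.linear scaleC scaleC U \<and> bij U \<and>
     (\<forall>x y. cinner (U x) (U y) = cinner x y)"

definition antiunitary :: "('a::complex_inner \<Rightarrow> 'a) \<Rightarrow> bool" where
  "antiunitary U \<longleftrightarrow> (\<forall>x y. U (x + y) = U x + U y) \<and> (\<forall>c x. U (c *\<^sub>C x) = cnj c *\<^sub>C U x) \<and>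
     bij U \<and> (\<forall>x y. cinner (U x) (U y) = cnj (cinner x y))"

definition finite_rank_selfadjoint :: "('a::complex_inner \<Rightarrow> 'a) set" where
  "finite_rank_selfadjoint = {A. bounded_clinear A \<and> is_cadjoint A A \<and> cfinite_dim (range A)}"

definition crank :: "('a::complex_inner \<Rightarrow> 'a) \<Rightarrow> nat" where
  "crank A = complex_vector.dim (range A)"

definition conjugacy_class :: "('a::complex_inner \<Rightarrow> 'a) set \<Rightarrow> bool" where
  "conjugacy_class C \<longleftrightarrow>
     (\<exists>A\<in>finite_rank_selfadjoint. C = {U \<circ> A \<circ> cadjoint U | U. unitary U})"

definition orthogonal_ops :: "('a::complex_inner \<Rightarrow> 'a) \<Rightarrow> ('a \<Rightarrow> 'a) \<Rightarrow> bool" where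
  "orthogonal_ops A B \<longleftrightarrow> A \<circ> B = (\<lambda>_. 0) \<and> B \<circ> A = (\<lambda>_. 0)"

end

theory Submission
  imports Defs
begin

text \<open>Since \<open>dim H > 2k\<close>, two members of the class have the same image iff they are orthogonal to the
  same members, and unitaries act transitively on \<open>k\<close>-dimensional subspaces; so \<open>f\<close> induces an
  orthogonality preserving bijection of the Grassmannian of \<open>k\<close>-dimensional subspaces. For
  distinct \<open>Y, Z\<close> inside a \<open>(k+1)\<close>-dimensional \<open>W\<close>, the \<open>k\<close>-dimensional subspaces of \<open>W\<close> are the
  elements of the double orthocomplement of \<open>{Y, Z}\<close>. Hence adjacency is preserved, the bijection
  descends to \<open>(k-1)\<close>-dimensional subspaces, and iteration reduces everything to \<open>k = 1\<close>.

  For \<open>k = 1\<close> (Uhlhorn's theorem), fix a unit vector \<open>e\<close> and a unit vector \<open>e'\<close> on the image of its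
  line, and let \<open>T x\<close>, for \<open>x\<close> orthogonal to \<open>e\<close>, be the vector orthogonal to \<open>e'\<close> such that
  the line of \<open>e + x\<close> goes to the line of \<open>e' + T x\<close>. Preservation of collinearity makes \<open>T\<close>
  additive and semilinear, and since \<open>e + x\<close> and \<open>e + y\<close> are orthogonal iff \<open>\<langle>x, y\<rangle> = -1\<close>, it also
  gives \<open>\<langle>T x, T y\<rangle> = s \<langle>x, y\<rangle>\<close> for the accompanying field homomorphism \<open>s\<close>. So \<open>s\<close> commutes
  with conjugation and is the identity or the conjugation.\<close>

section \<open>Inner products and orthogonal projections\<close>

lemma cinner_add_right: "cinner x (y + z) = cinner x y + cinner x z"
  by (metis cinner_add_left cinner_commute complex_cnj_add)

lemma cinner_scaleC_right: "cinner x (a *\<^sub>C y) = cnj a * cinner x y"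
  by (metis cinner_scaleC_left cinner_commute complex_cnj_mult)

lemma cinner_zero_left [simp]: "cinner 0 x = 0"
  using cinner_add_left[of 0 0 x] by simp

lemma cinner_zero_right [simp]: "cinner x 0 = 0"
  using cinner_add_right[of x 0 0] by simp

lemma cinner_minus_left: "cinner (- x) y = - cinner x y"
  using cinner_add_left[of x "- x" y] by (simp add: add_eq_0_iff)

lemma cinner_minus_right: "cinner y (- x) = - cinner y x"
  using cinner_add_right[of y x "- x"] by (simp add: add_eq_0_iff)

lemma cinner_diff_left: "cinner (x - z) y = cinner x y - cinner z y"
  using cinner_add_left[of x "- z" y] by (simp add: cinner_minus_left)

lemma cinner_diff_right: "cinner y (x - z) = cinner y x - cinner y z"
  using cinner_add_right[of y x "- z"] by (simp add: cinner_minus_right)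

lemma cinner_self_eq_0 [simp]: "cinner x x = 0 \<longleftrightarrow> x = 0"
  by (simp add: cinner_self_eq_norm)

lemma cinner_eq_0_commute: "cinner x y = 0 \<longleftrightarrow> cinner y x = 0"
  by (metis cinner_commute complex_cnj_zero)

lemmas cinner_simps = cinner_add_left cinner_add_right cinner_diff_left cinner_diff_right
  cinner_minus_left cinner_minus_right cinner_scaleC_left cinner_scaleC_right

lemma cinner_ext: "(\<And>z. cinner x z = cinner y z) \<Longrightarrow> x = y"
  by (metis cinner_diff_left cinner_self_eq_0 eq_iff_diff_eq_0)

lemma exists_unit_multiple:
  assumes "x \<noteq> (0::'a::complex_inner)"
  obtains c where "c \<noteq> 0" "cinner (c *\<^sub>C x) (c *\<^sub>C x) = 1"
proof
  show "complex_of_real (inverse (norm x)) \<noteq> 0"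
    using assms by simp
  show "cinner (complex_of_real (inverse (norm x)) *\<^sub>C x) (complex_of_real (inverse (norm x)) *\<^sub>C x) = 1"
    unfolding scaleC_of_real cinner_self_eq_norm using assms by simp
qed

definition perp :: "'a::complex_inner set \<Rightarrow> 'a set \<Rightarrow> bool" where
  "perp X Y \<longleftrightarrow> (\<forall>x\<in>X. \<forall>y\<in>Y. cinner x y = 0)"

lemma perpD: "perp X Y \<Longrightarrow> x \<in> X \<Longrightarrow> y \<in> Y \<Longrightarrow> cinner x y = 0"
  by (simp add: perp_def)

lemma perp_commute: "perp X Y \<longleftrightarrow> perp Y X"
  unfolding perp_def using cinner_eq_0_commute by blast

lemma perp_mono: "perp X Y \<Longrightarrow> X' \<subseteq> X \<Longrightarrow> Y' \<subseteq> Y \<Longrightarrow> perp X' Y'"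
  unfolding perp_def by blast

lemma subspace_orthogonal: "complex_vector.subspace {x. \<forall>y\<in>Y. cinner x y = 0}"
  by (rule complex_vector.subspaceI) (auto simp: cinner_simps)

lemma perp_span_left: "perp (complex_vector.span X) Y \<longleftrightarrow> perp X Y"
proof
  assume "perp X Y"
  then have "X \<subseteq> {x. \<forall>y\<in>Y. cinner x y = 0}" by (auto simp: perp_def)
  then have "complex_vector.span X \<subseteq> {x. \<forall>y\<in>Y. cinner x y = 0}"
    by (rule complex_vector.span_minimal) (rule subspace_orthogonal)
  then show "perp (complex_vector.span X) Y" by (auto simp: perp_def)
qed (erule perp_mono, auto simp: complex_vector.span_superset)

lemma perp_span_right: "perp X (complex_vector.span Y) \<longleftrightarrow> perp X Y"
  by (metis perp_commute perp_span_left)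

lemma perp_Un_right: "perp X (Y \<union> Z) \<longleftrightarrow> perp X Y \<and> perp X Z"
  by (auto simp: perp_def)

text \<open>Gram-Schmidt without normalisation: the new vector \<open>b\<close> contributes its
  component \<open>u\<close> orthogonal to the old span, and the remainder \<open>v\<close> of
  \<open>z\<close> is corrected along \<open>u\<close>.\<close>

lemma exists_orthogonal_decomposition:
  assumes "finite B"
  shows "\<exists>w u. z = w + u \<and> w \<in> complex_vector.span B \<and> perp {u} (complex_vector.span B)"
  using assms
proof (induction B arbitrary: z)
  case empty
  show ?case by (rule exI[of _ 0], rule exI[of _ z]) (simp add: perp_def)
next
  case (insert b B)
  obtain b0 u where b: "b = b0 + u" "b0 \<in> complex_vector.span B" "perp {u} (complex_vector.span B)"
    using insert.IH by blast
  obtain w v where z: "z = w + v" "w \<in> complex_vector.span B" "perp {v} (complex_vector.span B)"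
    using insert.IH by blast
  have sub: "complex_vector.span B \<subseteq> complex_vector.span (insert b B)"
    by (rule complex_vector.span_mono) auto
  have bi: "b \<in> complex_vector.span (insert b B)"
    by (rule complex_vector.span_base) simp
  \<comment> \<open>\<open>B\<close> may be dependent; then \<open>u\<close> can be 0, and division
    by zero gives \<open>c = 0\<close>, so nothing is corrected.\<close>
  define c where "c = cinner v u / cinner u u"
  have u: "u \<in> complex_vector.span (insert b B)"
    using b sub complex_vector.span_diff[OF bi, of b0] by auto
  have vu: "cinner (v - c *\<^sub>C u) u = 0"
    by (cases "u = 0") (simp_all add: c_def cinner_simps)
  have vB: "perp {v - c *\<^sub>C u} (complex_vector.span B)"
    using b(3) z(3) by (auto simp: perp_def cinner_simps)
  have "cinner (v - c *\<^sub>C u) b = 0"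
    using vu perpD[OF vB _ b(2), of "v - c *\<^sub>C u"] b(1) by (simp add: cinner_add_right)
  then have "perp {v - c *\<^sub>C u} (insert b B)"
    using vB[unfolded perp_span_right] by (simp add: perp_def)
  moreover have "w + c *\<^sub>C u \<in> complex_vector.span (insert b B)"
    using z(2) sub u by (intro complex_vector.span_add complex_vector.span_scale) auto
  ultimately show ?case
    using z(1) by (intro exI[of _ "w + c *\<^sub>C u"] exI[of _ "v - c *\<^sub>C u"]) (simp add: perp_span_right)
qed

text \<open>A finite-dimensional span equals its double orthocomplement, because a vector of the
  latter is orthogonal to its own component off the span. This turns collinearity into a statement
  about orthogonality.\<close>

lemma in_span_iff_orthogonal:
  assumes "finite B"
  shows "z \<in> complex_vector.span B \<longleftrightarrow> (\<forall>w. (\<forall>b\<in>B. cinner w b = 0) \<longrightarrow> cinner w z = 0)"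
proof
  assume z: "z \<in> complex_vector.span B"
  show "\<forall>w. (\<forall>b\<in>B. cinner w b = 0) \<longrightarrow> cinner w z = 0"
  proof (intro allI impI)
    fix w assume "\<forall>b\<in>B. cinner w b = 0"
    then have "perp {w} (complex_vector.span B)" unfolding perp_span_right by (simp add: perp_def)
    then show "cinner w z = 0" using z by (simp add: perp_def)
  qed
next
  assume *: "\<forall>w. (\<forall>b\<in>B. cinner w b = 0) \<longrightarrow> cinner w z = 0"
  obtain w u where z: "z = w + u" "w \<in> complex_vector.span B" "perp {u} (complex_vector.span B)"
    using exists_orthogonal_decomposition[OF assms] by blast
  have "cinner u z = 0"
    using * z(3)[unfolded perp_span_right] by (simp add: perp_def)
  moreover have "cinner u w = 0" using z by (simp add: perp_def)
  ultimately have "u = 0" using z(1) by (simp add: cinner_add_right)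
  then show "z \<in> complex_vector.span B" using z by simp
qed

lemma cdim_greater_mono: "cdim_greater S n \<Longrightarrow> m \<le> n \<Longrightarrow> cdim_greater S m"
  by (auto simp: cdim_greater_def)

lemma exists_orthogonal_vector:
  fixes B :: "'a::complex_inner set"
  assumes dim: "cdim_greater (UNIV :: 'a set) n" and "finite B" "card B \<le> n"
  obtains u where "u \<noteq> 0" "perp {u} B"
proof -
  have "complex_vector.span B \<noteq> UNIV"
  proof
    \<comment> \<open>A finite spanning set makes the space finite-dimensional, so that
      \<open>cdim_greater\<close> bounds the actual dimension.\<close>
    assume eq: "complex_vector.span B = UNIV"
    then have "complex_vector.dim (UNIV :: 'a set) > n"
      using dim assms(2) by (auto simp: cdim_greater_def cfinite_dim_def)
    moreover have "complex_vector.dim (UNIV :: 'a set) \<le> card B"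
      using complex_vector.dim_le_card[of UNIV B] eq assms(2) by auto
    ultimately show False using assms(3) by simp
  qed
  then obtain z where z: "z \<notin> complex_vector.span B" by blast
  obtain w u where "z = w + u" "w \<in> complex_vector.span B" "perp {u} (complex_vector.span B)"
    using exists_orthogonal_decomposition[OF assms(2)] by blast
  with z that show thesis by (metis add.right_neutral perp_span_right)
qed

section \<open>Endomorphisms of the complex field commuting with conjugation\<close>

text \<open>Rationals are fixed; positive reals are squares and so stay positive, hence
  \<open>g\<close> is increasing; density of the rationals leaves only the identity.\<close>

lemma real_ring_hom_eq_id:
  fixes g :: "real \<Rightarrow> real"
  assumes add: "\<And>x y. g (x + y) = g x + g y"
    and mult: "\<And>x y. g (x * y) = g x * g y" and one: "g 1 = 1"
  shows "g x = x"
proof -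
  have zero: "g 0 = 0" using add[of 0 0] by simp
  have minus: "g (- x) = - g x" for x using add[of x "- x"] zero by simp
  have nat: "g (of_nat n) = of_nat n" for n
    by (induction n) (simp_all add: zero one add)
  have int: "g (of_int n) = of_int n" for n
    using nat minus by (cases n rule: int_cases2) simp_all
  have rat: "g q = q" if "q \<in> \<rat>" for q
  proof -
    obtain a b where q: "q = of_int a / of_int b" "b > 0"
      using \<open>q \<in> \<rat>\<close> by (rule Rats_cases')
    then have "g q * of_int b = of_int a"
      using mult[of q "of_int b"] by (simp add: int)
    then have "g q = of_int a / of_int b" using q(2) by (simp add: eq_divide_eq)
    then show ?thesis using q(1) by simp
  qed
  have inj: "g x \<noteq> 0" if "x \<noteq> 0" for x
    using mult[of x "inverse x"] that one by auto
  have pos: "g x > 0" if "x > 0" for x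
  proof -
    have "g x = g (sqrt x) * g (sqrt x)"
      using mult[of "sqrt x" "sqrt x"] that by simp
    then have "g x \<ge> 0" by simp
    then show ?thesis using inj[of x] that by simp
  qed
  have mono: "g x < g y" if "x < y" for x y
    using pos[of "y - x"] add[of x "y - x"] that by simp
  show ?thesis
  proof (cases "g x" x rule: linorder_cases)
    case less
    then obtain q where "q \<in> \<rat>" "g x < q" "q < x" using Rats_dense_in_real by blast
    then show ?thesis using mono[of q x] rat[of q] by simp
  next
    case greater
    then obtain q where "q \<in> \<rat>" "x < q" "q < g x" using Rats_dense_in_real by blast
    then show ?thesis using mono[of x q] rat[of q] by simp
  qed
qed

text \<open>Commuting with conjugation forces reals to go to reals, where the previous lemma
  applies; \<i> must go to a square root of -1.\<close>

lemma complex_ring_hom_cnj: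
  fixes s :: "complex \<Rightarrow> complex"
  assumes add: "\<And>x y. s (x + y) = s x + s y"
    and mult: "\<And>x y. s (x * y) = s x * s y" and one: "s 1 = 1"
    and cnj: "\<And>x. s (cnj x) = cnj (s x)"
  shows "s = id \<or> s = cnj"
proof -
  have real: "s (of_real r) = of_real (Re (s (of_real r)))" for r
    using cnj[of "of_real r"] by (simp add: complex_eq_iff)
  have "Re (s (of_real r)) = r" for r
  proof (rule real_ring_hom_eq_id[where g = "\<lambda>r. Re (s (of_real r))"])
    fix x y
    show "Re (s (of_real (x * y))) = Re (s (of_real x)) * Re (s (of_real y))"
      using real[of x] real[of y] by (metis mult of_real_mult Re_complex_of_real)
  qed (simp_all add: add one)
  with real have id: "s (of_real r) = of_real r" for r by simp
  have "s \<i> * s \<i> = - 1"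
    using mult[of \<i> \<i>] id[of "-1"] by simp
  then have "(s \<i> - \<i>) * (s \<i> + \<i>) = 0"
    by (simp add: algebra_simps)
  then have i: "s \<i> = \<i> \<or> s \<i> = - \<i>"
    by (auto simp: add_eq_0_iff2)
  have z: "s z = of_real (Re z) + s \<i> * of_real (Im z)" for z
    by (subst complex_eq[of z]) (simp add: add mult id)
  show ?thesis
    using i
  proof
    assume "s \<i> = \<i>"
    have "s w = w" for w
      by (subst z) (simp add: \<open>s \<i> = \<i>\<close> complex_eq_iff)
    then have "s = id" by auto
    then show ?thesis ..
  next
    assume "s \<i> = - \<i>"
    have "s w = cnj w" for w
      by (subst z) (simp add: \<open>s \<i> = - \<i>\<close> complex_eq_iff)
    then have "s = cnj" by auto
    then show ?thesis ..
  qed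
qed

section \<open>Orthogonality preserving maps of the projective space\<close>

text \<open>Covers unitary (\<open>s = id\<close>) and anti-unitary (\<open>s = cnj\<close>)
  operators at once, so that arguments are made only once.\<close>

definition semiunitary :: "(complex \<Rightarrow> complex) \<Rightarrow> ('a::complex_inner \<Rightarrow> 'a) \<Rightarrow> bool" where
  "semiunitary s U \<longleftrightarrow> (\<forall>x y. U (x + y) = U x + U y) \<and> (\<forall>c x. U (c *\<^sub>C x) = s c *\<^sub>C U x) \<and>
     bij U \<and> (\<forall>x y. cinner (U x) (U y) = s (cinner x y))"

lemma unitary_iff_semiunitary: "unitary U \<longleftrightarrow> semiunitary id U"
  by (auto simp: unitary_def semiunitary_def Vector_Spaces.linear_iff complex_vector.vector_space_axioms)

lemma antiunitary_iff_semiunitary: "antiunitary U \<longleftrightarrow> semiunitary cnj U"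
  by (simp add: antiunitary_def semiunitary_def)

text \<open>A map of lines, encoded by representatives: only the line of \<open>h x\<close> matters,
  and no compatibility of \<open>h\<close> with sums or scalars is assumed. By
  \<open>surj_ray\<close> every line is hit.\<close>

locale ortho_map =
  fixes h :: "'a::complex_inner \<Rightarrow> 'a"
  assumes dim3: "cdim_greater (UNIV :: 'a set) 2"
    and ortho: "cinner (h x) (h y) = 0 \<longleftrightarrow> cinner x y = 0"
    and surj_ray: "\<exists>x c. y = c *\<^sub>C h x"
begin

lemma h_eq_0 [simp]: "h x = 0 \<longleftrightarrow> x = 0"
  using ortho[of x x] by simp

text \<open>A nonzero vector orthogonal to \<open>h x\<close> and \<open>h y\<close> is a multiple
  of some \<open>h v\<close>; by \<open>ortho\<close> this \<open>v\<close> is orthogonal to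
  \<open>x\<close> and \<open>y\<close>, hence to \<open>z\<close>. So \<open>h z\<close> lies in
  the double orthocomplement of \<open>{h x, h y}\<close>.\<close>

lemma h_collinear:
  assumes "z = a *\<^sub>C x + b *\<^sub>C y"
  obtains a' b' where "h z = a' *\<^sub>C h x + b' *\<^sub>C h y"
proof -
  have "h z \<in> complex_vector.span {h x, h y}"
  proof (subst in_span_iff_orthogonal, simp, intro allI impI)
    fix w assume w: "\<forall>b\<in>{h x, h y}. cinner w b = 0"
    obtain v c where v: "w = c *\<^sub>C h v" using surj_ray by blast
    show "cinner w (h z) = 0"
    proof (cases "c = 0")
      case False
      then have "cinner v x = 0" "cinner v y = 0"
        using w v ortho by (auto simp: cinner_simps)
      then have "cinner v z = 0" using assms by (simp add: cinner_simps)
      then show ?thesis using v ortho by (simp add: cinner_simps)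
    qed (use v in simp)
  qed
  then show thesis
    using that by (auto simp: complex_vector.span_insert complex_vector.span_empty algebra_simps
        elim!: diff_eq_eq[THEN iffD1, elim_format])
qed

lemma h_collinear_reflect:
  assumes "h x = c *\<^sub>C h y"
  obtains d where "x = d *\<^sub>C y"
proof -
  have "x \<in> complex_vector.span {y}"
  proof (subst in_span_iff_orthogonal, simp, intro allI impI)
    fix w assume "\<forall>b\<in>{y}. cinner w b = 0"
    then have "cinner (h w) (h y) = 0" using ortho by simp
    then have "cinner (h w) (h x) = 0" using assms by (simp add: cinner_simps)
    then show "cinner w x = 0" using ortho by simp
  qed
  then show thesis using that by (auto simp: complex_vector.span_singleton)
qed

end

section \<open>Affine charts around a base line and its image\<close>

locale ortho_map_base = ortho_map h for h :: "'a::complex_inner \<Rightarrow> 'a" +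
  fixes e e' :: "'a::complex_inner"
  assumes unit_e: "cinner e e = 1" and unit_e': "cinner e' e' = 1"
    and e': "\<exists>c. c \<noteq> 0 \<and> e' = c *\<^sub>C h e"
begin

lemma ortho_e': "cinner (h x) e' = 0 \<longleftrightarrow> cinner x e = 0"
  using e' ortho[of x e] by (auto simp: cinner_simps)

text \<open>\<open>h (e + x)\<close> is rescaled to have component 1 along \<open>e'\<close>, which
  is then removed. For \<open>x\<close> orthogonal to \<open>e\<close> the divisor is nonzero, since
  \<open>e + x\<close> is not orthogonal to \<open>e\<close>.\<close>

definition T :: "'a \<Rightarrow> 'a" where
  "T x = (1 / cinner (h (e + x)) e') *\<^sub>C h (e + x) - e'"

abbreviation H where "H \<equiv> {x. cinner x e = 0}"

lemma h_affine:
  assumes "x \<in> H"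
  obtains c where "c \<noteq> 0" "h (e + x) = c *\<^sub>C (e' + T x)"
proof -
  have "cinner (h (e + x)) e' \<noteq> 0"
    using assms unit_e ortho_e'[of "e + x"] by (simp add: cinner_simps)
  then show thesis
    by (intro that[of "cinner (h (e + x)) e'"]) (simp_all add: T_def complex_vector.scale_scale)
qed

lemma T_ortho_e': "x \<in> H \<Longrightarrow> cinner (T x) e' = 0"
  using unit_e unit_e' ortho_e'[of "e + x"] by (simp add: T_def cinner_simps)

lemma T_ortho_e'2: "x \<in> H \<Longrightarrow> cinner e' (T x) = 0"
  using T_ortho_e' cinner_eq_0_commute by blast

lemma T_0 [simp]: "T 0 = 0"
proof -
  obtain c where c: "e' = c *\<^sub>C h e" "c \<noteq> 0" using e' by blast
  then have "cinner (h e) e' = 1 / c"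
    using unit_e' by (metis cinner_scaleC_left nonzero_eq_divide_eq mult.commute)
  then have "T 0 = c *\<^sub>C h e - e'" by (simp only: T_def add_0_right) simp
  then show ?thesis using c(1) by simp
qed

text \<open>\<open>x\<close> lies in the span of \<open>e + x\<close> and \<open>e\<close>, so
  \<open>h x\<close> is a combination of \<open>e'\<close> and \<open>T x\<close>; both
  \<open>h x\<close> and \<open>T x\<close> are orthogonal to \<open>e'\<close>, so the coefficient
  of \<open>e'\<close> vanishes.\<close>

lemma h_T:
  assumes "x \<in> H"
  obtains d where "h x = d *\<^sub>C T x"
proof -
  have "x = 1 *\<^sub>C (e + x) + (-1) *\<^sub>C e" by simp
  then obtain a b where 1: "h x = a *\<^sub>C h (e + x) + b *\<^sub>C h e" by (rule h_collinear)
  obtain c where c: "h (e + x) = c *\<^sub>C (e' + T x)" using h_affine assms by blast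
  obtain r where r: "e' = r *\<^sub>C h e" "r \<noteq> 0" using e' by blast
  then have he: "h e = (1 / r) *\<^sub>C e'" by simp
  have 2: "h x = (a * c + b / r) *\<^sub>C e' + (a * c) *\<^sub>C T x"
    using 1 unfolding c he by (simp add: scaleC_add_left scaleC_add_right scaleC_scaleC)
  have "a * c + b / r = 0"
    using assms ortho_e'[of x] T_ortho_e'[of x] unit_e' unfolding 2 by (simp add: cinner_simps)
  then show thesis using 2 that[of "a * c"] by simp
qed

lemma T_eq_0 [simp]: "x \<in> H \<Longrightarrow> T x = 0 \<longleftrightarrow> x = 0"
  by (metis T_0 complex_vector.scale_zero_right h_T h_eq_0)

lemma T_ortho_iff:
  assumes "x \<in> H" "y \<in> H"
  shows "cinner (T x) (T y) = 0 \<longleftrightarrow> cinner x y = 0"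
proof (cases "x = 0 \<or> y = 0")
  case False
  obtain d where d: "h x = d *\<^sub>C T x" using h_T assms by blast
  obtain d' where d': "h y = d' *\<^sub>C T y" using h_T assms by blast
  have "d \<noteq> 0" "d' \<noteq> 0" using d d' False by (metis complex_vector.scale_zero_left h_eq_0)+
  then show ?thesis using ortho[of x y] unfolding d d' by (simp add: cinner_simps)
qed auto

text \<open>\<open>e + x\<close> and \<open>e + y\<close> have inner product
  \<open>1 + cinner x y\<close>, so -1 is a value that orthogonality can detect.\<close>

lemma T_inner_minus_1:
  assumes "x \<in> H" "y \<in> H" "cinner x y = -1"
  shows "cinner (T x) (T y) = -1"
proof -
  obtain c where c: "c \<noteq> 0" "h (e + x) = c *\<^sub>C (e' + T x)" using h_affine assms by blast
  obtain d where d: "d \<noteq> 0" "h (e + y) = d *\<^sub>C (e' + T y)" using h_affine assms by blast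
  have "cinner (e + x) (e + y) = 0"
    using assms unit_e cinner_eq_0_commute[of e y] by (simp add: cinner_simps)
  then have "cinner (e' + T x) (e' + T y) = 0"
    using ortho[of "e + x" "e + y"] c d by (simp add: cinner_scaleC_left cinner_scaleC_right)
  then have "1 + cinner (T x) (T y) = 0"
    using assms unit_e' T_ortho_e'[of x] T_ortho_e'2[of y] by (simp add: cinner_simps)
  then show ?thesis by (simp add: add_eq_0_iff)
qed

section \<open>Additivity of \<open>T\<close>\<close>

lemma T_add_multiple:
  assumes "x \<in> H" "y \<in> H"
  obtains b where "T (x + y) = T x + b *\<^sub>C T y"
proof -
  have xy: "x + y \<in> H" using assms by (simp add: cinner_simps)
  have "e + (x + y) = 1 *\<^sub>C (e + x) + 1 *\<^sub>C y" by simp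
  then obtain a b where 1: "h (e + (x + y)) = a *\<^sub>C h (e + x) + b *\<^sub>C h y" by (rule h_collinear)
  obtain c where c: "h (e + x) = c *\<^sub>C (e' + T x)" using h_affine assms by blast
  obtain d where d: "h y = d *\<^sub>C T y" using h_T assms by blast
  obtain r where r: "r \<noteq> 0" "h (e + (x + y)) = r *\<^sub>C (e' + T (x + y))" using h_affine[OF xy] by blast
  have 2: "r *\<^sub>C (e' + T (x + y)) = (a * c) *\<^sub>C (e' + T x) + (b * d) *\<^sub>C T y"
    using 1 unfolding c d r by (simp add: scaleC_scaleC)
  \<comment> \<open>Values of \<open>T\<close> are orthogonal to \<open>e'\<close>, so the
    components along \<open>e'\<close> compare the scalars and give \<open>T x\<close> the
    coefficient 1.\<close>
  have "r = a * c"
    using arg_cong[OF 2, of "\<lambda>z. cinner z e'"] assms xy T_ortho_e' unit_e'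
    by (simp add: cinner_simps)
  then have "r *\<^sub>C T (x + y) = r *\<^sub>C T x + (b * d) *\<^sub>C T y"
    using 2 by (simp add: scaleC_add_right)
  then have "(1 / r) *\<^sub>C (r *\<^sub>C T (x + y)) = (1 / r) *\<^sub>C (r *\<^sub>C T x + (b * d) *\<^sub>C T y)" by simp
  then have "T (x + y) = T x + (b * d / r) *\<^sub>C T y"
    using r(1) by (simp add: scaleC_add_right scaleC_scaleC)
  then show thesis by (rule that)
qed

lemma T_multiple:
  assumes "x \<in> H"
  obtains s where "T (a *\<^sub>C x) = s *\<^sub>C T x"
proof -
  have ax: "a *\<^sub>C x \<in> H" using assms by (simp add: cinner_simps)
  \<comment> \<open>A degenerate combination, with \<open>x\<close> taken twice:
    \<open>h_collinear\<close> then says that multiples go to multiples.\<close>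
  have "a *\<^sub>C x = a *\<^sub>C x + 0 *\<^sub>C x" by simp
  then obtain p q where 1: "h (a *\<^sub>C x) = p *\<^sub>C h x + q *\<^sub>C h x" by (rule h_collinear)
  obtain d where d: "h (a *\<^sub>C x) = d *\<^sub>C T (a *\<^sub>C x)" using h_T[OF ax] by blast
  obtain d' where d': "h x = d' *\<^sub>C T x" using h_T assms by blast
  show thesis
  proof (cases "d = 0")
    case True
    then have "a *\<^sub>C x = 0" using d h_eq_0 by (metis complex_vector.scale_zero_left)
    then show thesis using that[of 0] by (simp del: complex_vector.scale_eq_0_iff)
  next
    case False
    have "T (a *\<^sub>C x) = (1 / d) *\<^sub>C h (a *\<^sub>C x)" using d False by simp
    also have "\<dots> = ((p + q) * d' / d) *\<^sub>C T x"
      unfolding 1 d' by (simp add: scaleC_scaleC scaleC_add_left[symmetric] distrib_right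
          add_divide_distrib)
    finally show thesis by (rule that)
  qed
qed

lemma T_collinear_reflect:
  assumes "x \<in> H" "y \<in> H" "T x = c *\<^sub>C T y"
  obtains d where "x = d *\<^sub>C y"
proof (cases "y = 0")
  case True
  then show thesis using assms that by simp
next
  case False
  obtain a where a: "h x = a *\<^sub>C T x" using h_T assms by blast
  obtain b where b: "h y = b *\<^sub>C T y" using h_T assms by blast
  have "b \<noteq> 0" using b False by (metis complex_vector.scale_zero_left h_eq_0)
  then have "h x = (a * c / b) *\<^sub>C h y" unfolding a b assms(3) by (simp add: scaleC_scaleC)
  then show thesis using h_collinear_reflect that by blast
qed

text \<open>By symmetry \<open>T (x + y)\<close> is both \<open>T x + b *\<^sub>C T y\<close> and
  \<open>T y + a *\<^sub>C T x\<close>; since \<open>T\<close> reflects collinearity, this forces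
  \<open>a = 1\<close>.\<close>

lemma T_add_independent:
  assumes H: "x \<in> H" "y \<in> H" and "\<And>c. x \<noteq> c *\<^sub>C y" "y \<noteq> 0"
  shows "T (x + y) = T x + T y"
proof -
  obtain b where b: "T (x + y) = T x + b *\<^sub>C T y" using T_add_multiple H by blast
  obtain a where a: "T (x + y) = T y + a *\<^sub>C T x" using T_add_multiple[OF H(2,1)] by (metis add.commute)
  have eq: "(1 - a) *\<^sub>C T x = (1 - b) *\<^sub>C T y"
    using a b by (simp add: complex_vector.scale_left_diff_distrib algebra_simps)
  have "a = 1"
  proof (rule ccontr)
    assume "a \<noteq> 1"
    then have "T x = (1 / (1 - a)) *\<^sub>C ((1 - a) *\<^sub>C T x)" by simp
    then have "T x = ((1 - b) / (1 - a)) *\<^sub>C T y" unfolding eq by (simp add: scaleC_scaleC)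
    then show False using T_collinear_reflect[OF H] assms(3) by blast
  qed
  then show ?thesis using a by simp
qed

text \<open>Dimension greater than 2 leaves room in \<open>H\<close> for an auxiliary direction
  orthogonal to a given vector.\<close>

lemma exists_H_orthogonal:
  obtains z where "z \<in> H" "z \<noteq> 0" "cinner z x = 0"
proof -
  have "card {e, x} \<le> 2" by (simp add: card_insert_if)
  then obtain z where "z \<noteq> 0" "perp {z} {e, x}"
    using exists_orthogonal_vector[OF dim3, of "{e, x}"] by blast
  then show thesis using that[of z] by (auto simp: perp_def)
qed

lemma T_add_orthogonal:
  assumes H: "x \<in> H" "y \<in> H" and "cinner x y = 0"
  shows "T (x + y) = T x + T y"
proof (cases "x = 0 \<or> y = 0")
  case False
  have "x \<noteq> c *\<^sub>C y" for c
  proof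
    assume *: "x = c *\<^sub>C y"
    then have "c * cinner y y = 0" using assms(3) by (simp add: cinner_simps)
    then show False using * False by auto
  qed
  then show ?thesis using T_add_independent H False by blast
qed auto

text \<open>For dependent \<open>x\<close> and \<open>y\<close>, an auxiliary \<open>z\<close>
  orthogonal to \<open>y\<close> is added, and \<open>T (x + y + z)\<close> is split both as
  \<open>(x + y) + z\<close> and as \<open>(y + z) + x\<close>, where the earlier cases
  apply.\<close>

lemma T_add:
  assumes H: "x \<in> H" "y \<in> H"
  shows "T (x + y) = T x + T y"
proof (cases "y = 0")
  case False
  show ?thesis
  proof (cases "\<exists>c. x = c *\<^sub>C y")
    case True
    then obtain c where c: "x = c *\<^sub>C y" by blast
    obtain z where z: "z \<in> H" "z \<noteq> 0" "cinner z y = 0" using exists_H_orthogonal by blast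
    then have yz: "cinner y z = 0" using cinner_eq_0_commute by blast
    have mem: "x + y \<in> H" "y + z \<in> H" using H z by (auto simp: cinner_simps)
    have "T (x + y) + T z = T (x + y + z)"
      using T_add_orthogonal[OF mem(1) z(1)] yz c by (simp add: cinner_simps)
    also have "\<dots> = T (y + z + x)" by (simp add: algebra_simps)
    also have "\<dots> = T (y + z) + T x"
    proof (cases "x = 0")
      case False
      have "y + z \<noteq> d *\<^sub>C x" for d
      proof
        assume "y + z = d *\<^sub>C x"
        then have "cinner (y + z) z = cinner (d *\<^sub>C x) z" by simp
        then show False using yz c z(2) by (simp add: cinner_simps)
      qed
      then show ?thesis using T_add_independent[OF mem(2) H(1)] False by blast
    qed simp
    also have "\<dots> = T y + T z + T x" using T_add_orthogonal[OF H(2) z(1) yz] by simp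
    finally show ?thesis by simp
  qed (use T_add_independent H False in blast)
qed simp

section \<open>The field homomorphism accompanying \<open>T\<close>, and inner products\<close>

definition x0 :: 'a where "x0 = (SOME x. x \<in> H \<and> cinner x x = 1)"

lemma x0: "x0 \<in> H" "cinner x0 x0 = 1"
proof -
  obtain z where z: "z \<in> H" "z \<noteq> 0" using exists_H_orthogonal[of 0] by blast
  then obtain c where "cinner (c *\<^sub>C z) (c *\<^sub>C z) = 1" using exists_unit_multiple by metis
  then have "\<exists>x. x \<in> H \<and> cinner x x = 1" using z by (intro exI[of _ "c *\<^sub>C z"]) (simp add: cinner_simps)
  from someI_ex[OF this] show "x0 \<in> H" "cinner x0 x0 = 1" unfolding x0_def by auto
qed

lemma x0_nonzero [simp]: "x0 \<noteq> 0" using x0(2) by auto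

text \<open>The scalar is read off along the fixed direction \<open>x0\<close>;
  \<open>T_scale\<close> shows that every other direction gives the same one.\<close>

definition s :: "complex \<Rightarrow> complex" where
  "s a = cinner (T (a *\<^sub>C x0)) (T x0) / cinner (T x0) (T x0)"

lemma T_x0: "T (a *\<^sub>C x0) = s a *\<^sub>C T x0"
proof -
  obtain r where "T (a *\<^sub>C x0) = r *\<^sub>C T x0" using T_multiple x0(1) by blast
  then show ?thesis using x0 by (simp add: s_def cinner_simps)
qed

text \<open>\<open>T (a *\<^sub>C (x + y))\<close> is a multiple of \<open>T (x + y)\<close>;
  comparing components along the orthogonal vectors \<open>T x\<close> and \<open>T y\<close> shows
  that \<open>x\<close> and \<open>y\<close> have the same factor.\<close>

lemma T_scale_transfer:
  assumes H: "x \<in> H" "y \<in> H" and "cinner x y = 0" "x \<noteq> 0" and x: "T (a *\<^sub>C x) = r *\<^sub>C T x"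
  shows "T (a *\<^sub>C y) = r *\<^sub>C T y"
proof (cases "y = 0")
  case False
  obtain t where t: "T (a *\<^sub>C y) = t *\<^sub>C T y" using T_multiple H by blast
  have "x + y \<in> H" using H by (simp add: cinner_simps)
  then obtain u where "T (a *\<^sub>C (x + y)) = u *\<^sub>C T (x + y)" by (rule T_multiple)
  moreover have "T (a *\<^sub>C (x + y)) = T (a *\<^sub>C x) + T (a *\<^sub>C y)"
    using H by (subst T_add[symmetric]) (simp_all add: cinner_simps scaleC_add_right)
  ultimately have eq: "r *\<^sub>C T x + t *\<^sub>C T y = u *\<^sub>C T x + u *\<^sub>C T y"
    using H x t by (simp add: T_add scaleC_add_right)
  have o: "cinner (T x) (T y) = 0" "cinner (T y) (T x) = 0"
    using T_ortho_iff[OF H] assms(3) cinner_eq_0_commute by blast+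
  have "r = u"
    using arg_cong[OF eq, of "\<lambda>z. cinner z (T x)"] o assms by (simp add: cinner_simps)
  moreover have "t = u"
    using arg_cong[OF eq, of "\<lambda>z. cinner z (T y)"] o H False by (simp add: cinner_simps)
  ultimately show ?thesis using t by simp
qed simp

text \<open>The transfer works between orthogonal vectors only. So \<open>y\<close> is split into a
  multiple of \<open>x0\<close> and a part \<open>u\<close> orthogonal to \<open>x0\<close>:
  \<open>u\<close> gets its factor from \<open>x0\<close> directly, the multiple of
  \<open>x0\<close> by a detour through an orthogonal \<open>z\<close>.\<close>

lemma T_scale:
  assumes "y \<in> H"
  shows "T (a *\<^sub>C y) = s a *\<^sub>C T y"
proof -
  define c where "c = cinner y x0"
  define u where "u = y - c *\<^sub>C x0"
  obtain z where z: "z \<in> H" "z \<noteq> 0" "cinner z x0 = 0" using exists_H_orthogonal by blast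
  have zx: "cinner x0 z = 0" using z cinner_eq_0_commute by blast
  have u: "u \<in> H" "cinner x0 u = 0"
    using assms x0 cinner_commute[of x0 y] by (simp_all add: u_def c_def cinner_simps)
  have cx: "c *\<^sub>C x0 \<in> H" using x0 by (simp add: cinner_simps)
  have 1: "T (a *\<^sub>C z) = s a *\<^sub>C T z"
    using T_scale_transfer[OF x0(1) z(1) zx _ T_x0] by simp
  have 2: "T (a *\<^sub>C c *\<^sub>C x0) = s a *\<^sub>C T (c *\<^sub>C x0)"
    using T_scale_transfer[OF z(1) cx _ z(2) 1] z by (simp add: cinner_simps)
  have 3: "T (a *\<^sub>C u) = s a *\<^sub>C T u"
    using T_scale_transfer[OF x0(1) u(1) u(2) _ T_x0] by simp
  have "y = u + c *\<^sub>C x0" by (simp add: u_def)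
  moreover have "a *\<^sub>C u \<in> H" "a *\<^sub>C c *\<^sub>C x0 \<in> H" using u cx by (simp_all add: cinner_scaleC_left)
  ultimately show ?thesis using u(1) cx 2 3 by (simp only: scaleC_add_right T_add)
qed

lemma s_cancel:
  assumes "a *\<^sub>C T x0 = b *\<^sub>C T x0"
  shows "a = b"
  using assms x0 by simp

lemma s_1: "s 1 = 1"
  using T_x0[of 1] x0 by (intro s_cancel) simp

lemma s_add: "s (a + b) = s a + s b"
proof (rule s_cancel)
  have "s (a + b) *\<^sub>C T x0 = T (a *\<^sub>C x0 + b *\<^sub>C x0)" by (simp add: T_x0[symmetric] scaleC_add_left)
  also have "\<dots> = T (a *\<^sub>C x0) + T (b *\<^sub>C x0)" using x0 by (intro T_add) (simp_all add: cinner_simps)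
  finally show "s (a + b) *\<^sub>C T x0 = (s a + s b) *\<^sub>C T x0" by (simp add: T_x0 scaleC_add_left)
qed

lemma s_mult: "s (a * b) = s a * s b"
proof (rule s_cancel)
  have "s (a * b) *\<^sub>C T x0 = T (a *\<^sub>C b *\<^sub>C x0)" by (simp add: T_x0[symmetric] scaleC_scaleC)
  also have "\<dots> = s a *\<^sub>C T (b *\<^sub>C x0)" using x0 by (intro T_scale) (simp_all add: cinner_simps)
  finally show "s (a * b) *\<^sub>C T x0 = (s a * s b) *\<^sub>C T x0" by (simp add: T_x0 scaleC_scaleC)
qed

lemma s_0 [simp]: "s 0 = 0"
  using s_add[of 0 0] by simp

lemma s_minus: "s (- a) = - s a"
  using s_add[of a "- a"] by (simp add: add_eq_0_iff)

lemma s_eq_0 [simp]: "s a = 0 \<longleftrightarrow> a = 0"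
  by (metis mult_zero_left right_inverse s_0 s_1 s_mult zero_neq_one)

text \<open>Rescaling \<open>x\<close> moves a nonzero inner product to -1, where
  \<open>T_inner_minus_1\<close> applies; semilinearity undoes the rescaling.\<close>

lemma T_inner:
  assumes H: "x \<in> H" "y \<in> H"
  shows "cinner (T x) (T y) = s (cinner x y)"
proof (cases "cinner x y = 0")
  case True
  then show ?thesis using T_ortho_iff H by simp
next
  case False
  define a where "a = cinner x y"
  have "cinner (T ((- 1 / a) *\<^sub>C x)) (T y) = - 1"
    using H False by (intro T_inner_minus_1) (simp_all add: cinner_simps a_def)
  then have *: "s (- 1 / a) * cinner (T x) (T y) = - 1"
    by (simp only: T_scale[OF H(1)] cinner_scaleC_left)
  have "s a * s (- 1 / a) = - 1"
    using s_mult[of a "- 1 / a"] False by (simp add: a_def s_minus s_1)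
  then have "cinner (T x) (T y) = - (s a * s (- 1 / a)) * cinner (T x) (T y)" by simp
  also have "\<dots> = - s a * (s (- 1 / a) * cinner (T x) (T y))" by (simp add: algebra_simps)
  also have "\<dots> = s a" unfolding * by simp
  finally show ?thesis by (simp add: a_def)
qed

text \<open>Conjugate symmetry of \<open>cinner\<close>, evaluated through \<open>T_inner\<close> at
  \<open>x0\<close> and \<open>a *\<^sub>C x0\<close>.\<close>

lemma s_cnj: "s (cnj a) = cnj (s a)"
proof -
  have ax: "a *\<^sub>C x0 \<in> H" using x0 by (simp add: cinner_simps)
  have "s (cnj a) = cinner (T x0) (T (a *\<^sub>C x0))"
    using x0 T_inner[OF x0(1) ax] by (simp add: cinner_simps)
  also have "\<dots> = cnj (cinner (T (a *\<^sub>C x0)) (T x0))" by (rule cinner_commute)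
  also have "\<dots> = cnj (s a)" using x0 T_inner[OF ax x0(1)] by (simp add: cinner_simps)
  finally show ?thesis .
qed

lemma s_id_or_cnj: "s = id \<or> s = cnj"
  by (rule complex_ring_hom_cnj) (simp_all add: s_add s_mult s_1 s_cnj)

section \<open>The semiunitary operator that induces \<open>h\<close>\<close>

definition U :: "'a \<Rightarrow> 'a" where
  "U x = s (cinner x e) *\<^sub>C e' + T (x - cinner x e *\<^sub>C e)"

lemma component_in_H: "x - cinner x e *\<^sub>C e \<in> H"
  using unit_e by (simp add: cinner_simps)

lemma U_add: "U (x + y) = U x + U y"
proof -
  have "x + y - cinner (x + y) e *\<^sub>C e = (x - cinner x e *\<^sub>C e) + (y - cinner y e *\<^sub>C e)"
    by (simp add: cinner_simps scaleC_add_left)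
  then have "U (x + y) = s (cinner (x + y) e) *\<^sub>C e' + (T (x - cinner x e *\<^sub>C e) + T (y - cinner y e *\<^sub>C e))"
    by (simp only: U_def T_add[OF component_in_H component_in_H])
  then show ?thesis
    by (simp add: U_def cinner_add_left s_add scaleC_add_left)
qed

lemma U_scale: "U (a *\<^sub>C x) = s a *\<^sub>C U x"
proof -
  have "a *\<^sub>C x - cinner (a *\<^sub>C x) e *\<^sub>C e = a *\<^sub>C (x - cinner x e *\<^sub>C e)"
    by (simp add: cinner_simps complex_vector.scale_right_diff_distrib scaleC_scaleC)
  then show ?thesis
    using T_scale[OF component_in_H, of a x]
    by (simp add: U_def cinner_scaleC_left s_mult scaleC_add_right scaleC_scaleC)
qed

lemma U_inner: "cinner (U x) (U y) = s (cinner x y)"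
proof -
  let ?x = "x - cinner x e *\<^sub>C e" and ?y = "y - cinner y e *\<^sub>C e"
  have "cinner (U x) (U y) = s (cinner x e) * cnj (s (cinner y e)) + cinner (T ?x) (T ?y)"
    using T_ortho_e'[OF component_in_H, of x] T_ortho_e'2[OF component_in_H, of y] unit_e'
    by (simp add: U_def cinner_add_left cinner_add_right cinner_scaleC_left cinner_scaleC_right)
  also have "\<dots> = s (cinner x e * cnj (cinner y e) + cinner ?x ?y)"
    by (simp only: T_inner[OF component_in_H component_in_H] s_cnj[symmetric] s_mult s_add)
  also have "cinner x e * cnj (cinner y e) + cinner ?x ?y = cinner x y"
    using unit_e cinner_commute[of e y] by (simp add: cinner_simps algebra_simps)
  finally show ?thesis .
qed

text \<open>Off \<open>H\<close>, \<open>x\<close> is a multiple of some \<open>e + y\<close> with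
  \<open>y \<in> H\<close>, whose image line contains \<open>e' + T y\<close>, that is,
  \<open>U (e + y)\<close>; on \<open>H\<close> the operator \<open>U\<close> is
  \<open>T\<close>.\<close>

lemma h_U:
  obtains c where "h x = c *\<^sub>C U x"
proof (cases "cinner x e = 0")
  case True
  then show thesis using h_T[of x] that by (auto simp: U_def)
next
  case False
  define a where "a = cinner x e"
  define y where "y = (1 / a) *\<^sub>C (x - a *\<^sub>C e)"
  have y: "y \<in> H" using unit_e by (simp add: y_def a_def cinner_simps)
  have x: "x = a *\<^sub>C (e + y)"
    using False by (simp add: y_def a_def scaleC_add_right scaleC_scaleC)
  then have "x = a *\<^sub>C (e + y) + 0 *\<^sub>C (e + y)" using x by simp
  then obtain p q where pq: "h x = p *\<^sub>C h (e + y) + q *\<^sub>C h (e + y)" by (rule h_collinear)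
  obtain c where c: "h (e + y) = c *\<^sub>C (e' + T y)" using h_affine[OF y] by blast
  have "U x = s a *\<^sub>C U (e + y)" using x U_scale by metis
  also have "U (e + y) = e' + T y" using y unit_e by (simp add: U_def cinner_simps s_1)
  finally have "e' + T y = (1 / s a) *\<^sub>C U x" using False by (simp add: a_def)
  then have "h x = ((p + q) * c / s a) *\<^sub>C U x"
    unfolding pq c by (simp add: scaleC_scaleC scaleC_add_left[symmetric] distrib_right
        add_divide_distrib)
  then show thesis by (rule that)
qed

lemma U_bij: "bij U"
proof (rule bijI)
  show "inj U"
  proof (rule injI)
    fix x y assume "U x = U y"
    then have "s (cinner x z) = s (cinner y z)" for z
      using U_inner[of x z] U_inner[of y z] by simp
    then have "s (cinner (x - y) z) = 0" for z
      using s_add[of "cinner x z" "- cinner y z"] unfolding s_minus by (simp only: cinner_diff_left) simp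
    then have "cinner (x - y) (x - y) = 0" by (simp only: s_eq_0)
    then show "x = y" by simp
  qed
  show "surj U"
  proof
    show "UNIV \<subseteq> range U"
    proof
      fix y
      obtain x c where y: "y = c *\<^sub>C h x" using surj_ray by blast
      obtain d where d: "h x = d *\<^sub>C U x" using h_U by blast
      \<comment> \<open>\<open>s\<close> is an involution, so every scalar is a value of
        \<open>s\<close> and can be moved inside \<open>U\<close>.\<close>
      have "s (s (c * d)) = c * d" using s_id_or_cnj by auto
      then have "y = U (s (c * d) *\<^sub>C x)" using y d by (simp add: U_scale scaleC_scaleC)
      then show "y \<in> range U" by blast
    qed
  qed simp
qed

lemma U_semiunitary: "semiunitary s U"
  by (simp add: semiunitary_def U_add U_scale U_inner U_bij)

end

lemma (in ortho_map) induced_by_unitary_or_antiunitary: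
  "\<exists>U. (unitary U \<or> antiunitary U) \<and> (\<forall>x. \<exists>c. h x = c *\<^sub>C U x)"
proof -
  obtain z :: 'a where z: "z \<noteq> 0"
    using exists_orthogonal_vector[OF dim3, of "{}"] by (metis card.empty finite.emptyI le0)
  then obtain c where c: "cinner (c *\<^sub>C z) (c *\<^sub>C z) = 1" by (metis exists_unit_multiple)
  define e where "e = c *\<^sub>C z"
  have "h e \<noteq> 0" using c by (auto simp: e_def)
  then obtain d where d: "d \<noteq> 0" "cinner (d *\<^sub>C h e) (d *\<^sub>C h e) = 1" by (metis exists_unit_multiple)
  interpret B: ortho_map_base h e "d *\<^sub>C h e"
    using c d by unfold_locales (auto simp: e_def)
  have "unitary B.U \<or> antiunitary B.U"
    using B.U_semiunitary B.s_id_or_cnj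
    by (auto simp: unitary_iff_semiunitary antiunitary_iff_semiunitary)
  then show ?thesis using B.h_U by metis
qed

section \<open>Finite-dimensional subspaces\<close>

text \<open>Encoding by a basis of \<open>k\<close> vectors builds in finite dimension;
  \<open>complex_vector.dim\<close> alone would not, being 0 on infinite-dimensional subspaces
  too.\<close>

definition grass :: "nat \<Rightarrow> 'a::complex_inner set set" where
  "grass k = {complex_vector.span B | B. finite B \<and> complex_vector.independent B \<and> card B = k}"

lemma grassI:
  "finite B \<Longrightarrow> complex_vector.independent B \<Longrightarrow> card B = k \<Longrightarrow> complex_vector.span B \<in> grass k"
  by (auto simp: grass_def)

lemma grassE:
  assumes "X \<in> grass k"
  obtains B where "finite B" "complex_vector.independent B" "card B = k" "X = complex_vector.span B"
  using assms by (auto simp: grass_def)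

lemma grass_subspace: "X \<in> grass k \<Longrightarrow> complex_vector.subspace X"
  by (auto simp: grass_def complex_vector.subspace_span)

lemma grass_span: "X \<in> grass k \<Longrightarrow> complex_vector.span X = X"
  by (simp add: grass_subspace complex_vector.span_eq_iff)

lemma grass_zero: "X \<in> grass k \<Longrightarrow> 0 \<in> X"
  by (simp add: grass_subspace complex_vector.subspace_0)

lemma span_insert_span:
  "complex_vector.span (insert x (complex_vector.span B)) = complex_vector.span (insert x B)"
  by (auto simp: complex_vector.span_breakdown_eq complex_vector.span_span)

lemma span_insert_superset: "X \<subseteq> complex_vector.span (insert x X)"
  using complex_vector.span_superset[of "insert x X"] by simp

lemma in_span_insert: "x \<in> complex_vector.span (insert x X)"
  by (simp add: complex_vector.span_base)

lemma grass_insert: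
  assumes "X \<in> grass k" "x \<notin> X"
  shows "complex_vector.span (insert x X) \<in> grass (Suc k)"
proof -
  obtain B where B: "finite B" "complex_vector.independent B" "card B = k" "X = complex_vector.span B"
    using assms(1) by (rule grassE)
  have "x \<notin> B" using assms(2) B(4) complex_vector.span_base by blast
  then have "complex_vector.span (insert x B) \<in> grass (Suc k)"
    using B assms(2) by (intro grassI) (auto simp: complex_vector.independent_insert)
  then show ?thesis by (simp add: B(4) span_insert_span)
qed

lemma grass_le:
  assumes "X \<in> grass k" "Y \<in> grass m" "X \<subseteq> Y"
  shows "k \<le> m"
proof -
  obtain B where B: "finite B" "complex_vector.independent B" "card B = k" "X = complex_vector.span B"
    using assms(1) by (rule grassE)
  obtain D where D: "finite D" "complex_vector.independent D" "card D = m" "Y = complex_vector.span D"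
    using assms(2) by (rule grassE)
  have "B \<subseteq> complex_vector.span D" using assms(3) B(4) D(4) complex_vector.span_superset by blast
  then show ?thesis
    using complex_vector.independent_span_bound[OF D(1) B(2)] B(3) D(3) by simp
qed

lemma span_insert_subset:
  assumes "Y \<in> grass m" "X \<subseteq> Y" "y \<in> Y"
  shows "complex_vector.span (insert y X) \<subseteq> Y"
  using assms by (intro complex_vector.span_minimal) (auto simp: grass_subspace)

lemma grass_eq:
  assumes "X \<in> grass k" "Y \<in> grass k" "X \<subseteq> Y"
  shows "X = Y"
proof (rule ccontr)
  assume "X \<noteq> Y"
  then obtain y where "y \<in> Y" "y \<notin> X" using assms(3) by blast
  then have "Suc k \<le> k"
    using grass_le[OF grass_insert[OF assms(1)] assms(2)] span_insert_subset assms by blast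
  then show False by simp
qed

lemma grass_unique: "X \<in> grass k \<Longrightarrow> X \<in> grass m \<Longrightarrow> k = m"
  by (meson grass_le le_antisym order_refl)

lemma grass_subspace_of:
  assumes "X \<in> grass k" "complex_vector.subspace V" "V \<subseteq> X"
  obtains j where "j \<le> k" "V \<in> grass j"
proof -
  obtain B where B: "finite B" "complex_vector.independent B" "card B = k" "X = complex_vector.span B"
    using assms(1) by (rule grassE)
  obtain D where D: "D \<subseteq> V" "complex_vector.independent D" "V \<subseteq> complex_vector.span D"
    by (rule complex_vector.maximal_independent_subset)
  have "finite D \<and> card D \<le> card B"
    using B D assms(3) by (intro complex_vector.independent_span_bound) auto
  moreover have "V = complex_vector.span D"
    using D assms(2) by (simp add: complex_vector.span_minimal subset_antisym)
  ultimately show thesis using that[of "card D"] B D by (auto simp: grass_def)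
qed

lemma grass_between:
  assumes "j \<le> k" "X \<in> grass j" "Y \<in> grass m" "X \<subseteq> Y" "k \<le> m"
  obtains Z where "Z \<in> grass k" "X \<subseteq> Z" "Z \<subseteq> Y"
proof -
  have "\<exists>Z\<in>grass k. X \<subseteq> Z \<and> Z \<subseteq> Y"
    using assms(1,5)
  proof (induction rule: dec_induct)
    case base
    then show ?case using assms by blast
  next
    case (step k)
    then obtain Z where Z: "Z \<in> grass k" "X \<subseteq> Z" "Z \<subseteq> Y" by auto
    then have "Z \<noteq> Y" using grass_unique[of Z k m] assms(3) step.prems by auto
    then obtain y where y: "y \<in> Y" "y \<notin> Z" using Z by blast
    have "X \<subseteq> complex_vector.span (insert y Z)"
      using Z(2) span_insert_superset by (rule subset_trans)
    then show ?case
      using grass_insert[OF Z(1) y(2)] span_insert_subset[OF assms(3) Z(3) y(1)] by blast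
  qed
  then show thesis using that by blast
qed

lemma grass_0: "grass 0 = {{0}}"
  by (auto simp: grass_def complex_vector.independent_empty intro!: exI[of _ "{}"])

lemma grass_0_subset: "X \<in> grass k \<Longrightarrow> {0} \<subseteq> X"
  by (simp add: grass_zero)

lemma span_singleton_in_grass: "x \<noteq> 0 \<Longrightarrow> complex_vector.span {x} \<in> grass 1"
  using grass_insert[of "{0}" 0 x] by (simp add: grass_0 complex_vector.span_insert_0 insert_commute)

lemma grass_1_nonzero:
  assumes "X \<in> grass 1"
  obtains x where "x \<in> X" "x \<noteq> 0"
proof -
  have "X \<notin> grass 0" using grass_unique[OF assms, of 0] by (metis zero_neq_one)
  then have "X \<noteq> {0}" by (simp add: grass_0)
  then show thesis using grass_zero[OF assms] that by blast
qed

lemma grass_1_eq_span: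
  assumes "X \<in> grass 1" "x \<in> X" "x \<noteq> 0"
  shows "X = complex_vector.span {x}"
proof -
  have "complex_vector.span {x} \<subseteq> X"
    using assms by (intro complex_vector.span_minimal) (auto simp: grass_subspace)
  then show ?thesis using grass_eq[OF span_singleton_in_grass] assms by blast
qed

lemma grass_through:
  assumes "Y \<in> grass m" "y \<in> Y" "1 \<le> k" "k \<le> m"
  obtains Z where "Z \<in> grass k" "y \<in> Z" "Z \<subseteq> Y"
proof (cases "y = 0")
  \<comment> \<open>The zero vector spans no line, so a subspace above \<open>{0}\<close> is taken
    instead.\<close>
  case True
  have "{0} \<in> grass 0" by (simp add: grass_0)
  then show thesis
    using grass_between[of 0 k "{0}" Y m] grass_0_subset assms that True by auto
next
  case False
  have "complex_vector.span {y} \<subseteq> Y"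
    using assms by (intro complex_vector.span_minimal) (auto simp: grass_subspace)
  then obtain Z where "Z \<in> grass k" "complex_vector.span {y} \<subseteq> Z" "Z \<subseteq> Y"
    using grass_between[OF assms(3) span_singleton_in_grass[OF False] assms(1) _ assms(4)] by blast
  then show thesis using that complex_vector.span_base[of y "{y}"] by blast
qed

text \<open>One vector of \<open>Y\<close> outside \<open>X\<close> already extends \<open>X\<close>
  to the whole of \<open>W\<close>, by dimension.\<close>

lemma grass_span_Un:
  assumes "X \<in> grass k" "Y \<in> grass k" "X \<noteq> Y" "W \<in> grass (Suc k)" "X \<subseteq> W" "Y \<subseteq> W"
  shows "complex_vector.span (X \<union> Y) = W"
proof -
  obtain y where y: "y \<in> Y" "y \<notin> X" using grass_eq[OF assms(2,1)] assms(3) by blast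
  have "complex_vector.span (insert y X) = W"
    using grass_eq[OF grass_insert[OF assms(1) y(2)] assms(4)] span_insert_subset assms y by blast
  then have "W \<subseteq> complex_vector.span (X \<union> Y)"
    using complex_vector.span_mono[of "insert y X" "X \<union> Y"] y by auto
  moreover have "complex_vector.span (X \<union> Y) \<subseteq> W"
    using assms by (intro complex_vector.span_minimal) (auto simp: grass_subspace)
  ultimately show ?thesis by simp
qed

text \<open>The dimension formula for two hyperplanes of \<open>W\<close>: with \<open>v\<close> in
  \<open>Y\<close> but not in \<open>X\<close>, subtracting a multiple of \<open>v\<close> moves
  each vector of \<open>Y\<close> into \<open>X\<close>, so \<open>Y\<close> is
  \<open>X \<inter> Y\<close> enlarged by \<open>v\<close>.\<close>

lemma grass_Int:
  assumes X: "X \<in> grass (Suc k)" and Y: "Y \<in> grass (Suc k)" and "X \<noteq> Y"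
    and W: "W \<in> grass (Suc (Suc k))" "X \<subseteq> W" "Y \<subseteq> W"
  shows "X \<inter> Y \<in> grass k"
proof -
  obtain v where v: "v \<in> Y" "v \<notin> X" using grass_eq[OF Y X] assms(3) by blast
  have W_eq: "complex_vector.span (insert v X) = W"
    using grass_eq[OF grass_insert[OF X v(2)] W(1)] span_insert_subset W v by blast
  have sub: "complex_vector.subspace (X \<inter> Y)"
    using X Y by (intro complex_vector.subspace_inter) (auto simp: grass_subspace)
  obtain j where j: "X \<inter> Y \<in> grass j"
    using grass_subspace_of[OF X sub] by blast
  have "Y \<subseteq> complex_vector.span (insert v (X \<inter> Y))"
  proof
    fix y assume y: "y \<in> Y"
    then have "y \<in> complex_vector.span (insert v X)" unfolding W_eq using W(3) by blast
    then obtain c where "y - c *\<^sub>C v \<in> X"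
      unfolding complex_vector.span_breakdown_eq grass_span[OF X] by blast
    moreover have "y - c *\<^sub>C v \<in> Y"
      using y v Y by (simp add: grass_subspace complex_vector.subspace_diff complex_vector.subspace_scale)
    ultimately show "y \<in> complex_vector.span (insert v (X \<inter> Y))"
      unfolding complex_vector.span_breakdown_eq using complex_vector.span_base[of _ "X \<inter> Y"] by blast
  qed
  then have "Y = complex_vector.span (insert v (X \<inter> Y))"
    using span_insert_subset[OF Y, of "X \<inter> Y" v] v by blast
  then have "Y \<in> grass (Suc j)" using grass_insert[OF j, of v] v by simp
  then have "j = k" using grass_unique[OF Y] by auto
  then show ?thesis using j by simp
qed

text \<open>A converse to \<open>grass_Int\<close>: for \<open>y\<close> in \<open>Y\<close> outside
  \<open>X\<close>, \<open>Y\<close> is \<open>S\<close> enlarged by \<open>y\<close>, so the join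
  is \<open>X\<close> enlarged by \<open>y\<close>. Adjacency can thus be read off the meet or the
  join.\<close>

lemma grass_join:
  assumes S: "S \<in> grass k" and X: "X \<in> grass (Suc k)" and Y: "Y \<in> grass (Suc k)" and "X \<noteq> Y"
    and "S \<subseteq> X" "S \<subseteq> Y"
  shows "complex_vector.span (X \<union> Y) \<in> grass (Suc (Suc k))" "X \<inter> Y = S"
proof -
  obtain y where y: "y \<in> Y" "y \<notin> X" using grass_eq[OF Y X] assms(4) by blast
  have W: "complex_vector.span (insert y X) \<in> grass (Suc (Suc k))"
    using grass_insert[OF X y(2)] .
  have XW: "X \<subseteq> complex_vector.span (insert y X)" by (rule span_insert_superset)
  have "Y = complex_vector.span (insert y S)"
    using grass_eq[OF grass_insert[OF S] Y] span_insert_subset[OF Y \<open>S \<subseteq> Y\<close> y(1)] y assms(5) by blast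
  then have YW: "Y \<subseteq> complex_vector.span (insert y X)"
    using assms(5) complex_vector.span_mono[of "insert y S" "insert y X"] by auto
  show "complex_vector.span (X \<union> Y) \<in> grass (Suc (Suc k))"
    using grass_span_Un[OF X Y assms(4) W XW YW] W by simp
  show "X \<inter> Y = S"
    using grass_eq[OF S grass_Int[OF X Y assms(4) W XW YW]] assms by blast
qed

text \<open>\<open>N\<close> grows from the line of \<open>u\<close> by vectors orthogonal to both
  \<open>N\<close> and \<open>W\<close>. Passing from dimension \<open>k + 1\<close> to
  \<open>k + 2\<close> takes a vector orthogonal to at most \<open>m + k + 1 \<le> n\<close>
  vectors.\<close>

lemma exists_orthogonal_grass:
  fixes u :: "'a::complex_inner"
  assumes dim: "cdim_greater (UNIV :: 'a set) n" and W: "W \<in> grass m" and u: "u \<noteq> 0" "perp {u} W"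
  shows "m + k \<le> n \<Longrightarrow> \<exists>N\<in>grass (Suc k). u \<in> N \<and> perp N W"
proof (induction k)
  case 0
  show ?case
    using span_singleton_in_grass[OF u(1)] u(2)
    by (intro bexI[of _ "complex_vector.span {u}"]) (auto simp: perp_span_left complex_vector.span_base)
next
  case (Suc k)
  then obtain N where N: "N \<in> grass (Suc k)" "u \<in> N" "perp N W" by auto
  obtain B where B: "finite B" "card B = Suc k" "N = complex_vector.span B"
    using N(1) by (auto elim: grassE)
  obtain D where D: "finite D" "card D = m" "W = complex_vector.span D"
    using W by (auto elim: grassE)
  have "finite (B \<union> D)" "card (B \<union> D) \<le> n"
    using card_Un_le[of B D] B D Suc.prems by simp_all
  then obtain v where v: "v \<noteq> 0" "perp {v} (B \<union> D)"
    by (rule exists_orthogonal_vector[OF dim])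
  then have vN: "perp {v} N" "perp {v} W" by (auto simp: B(3) D(3) perp_span_right perp_Un_right)
  then have "v \<notin> N" using v(1) perpD[of "{v}" N v v] by auto
  moreover have "perp (complex_vector.span (insert v N)) W"
    using N(3) vN(2) by (simp add: perp_span_left) (simp add: perp_def)
  moreover have "u \<in> complex_vector.span (insert v N)"
    using N(2) by (simp add: complex_vector.span_base)
  ultimately show ?case using grass_insert[OF N(1)] by blast
qed

text \<open>The component \<open>u\<close> of \<open>z\<close> orthogonal to \<open>W\<close> is not
  orthogonal to \<open>z\<close>, so any \<open>N\<close> through \<open>u\<close> and orthogonal to
  \<open>W\<close> separates. For \<open>n = 2 * k\<close> the bound just admits
  \<open>m = k + 1\<close>, the case needed for adjacency.\<close>

lemma exists_separating_grass:
  fixes z :: "'a::complex_inner"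
  assumes dim: "cdim_greater (UNIV :: 'a set) n" and W: "W \<in> grass m" and "z \<notin> W"
    and "m + k \<le> Suc n" "1 \<le> k"
  obtains N where "N \<in> grass k" "perp N W" "\<not> perp N {z}"
proof -
  obtain B where B: "finite B" "W = complex_vector.span B"
    using W by (auto elim: grassE)
  obtain w u where z: "z = w + u" "w \<in> W" "perp {u} W"
    using exists_orthogonal_decomposition[OF B(1)] B(2) by blast
  then have "u \<noteq> 0" using assms(3) by auto
  have k: "m + (k - 1) \<le> n" "Suc (k - 1) = k" using assms by auto
  obtain N where N: "N \<in> grass k" "u \<in> N" "perp N W"
    using exists_orthogonal_grass[OF dim W \<open>u \<noteq> 0\<close> z(3) k(1)] k(2) by auto
  have "cinner u z = cinner u u" using z by (simp add: cinner_add_right perp_def)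
  then have "cinner u z \<noteq> 0" using \<open>u \<noteq> 0\<close> by simp
  then have "\<not> perp N {z}" using N(2) by (auto simp: perp_def)
  then show thesis using N assms(5) by (intro that[of N])
qed

section \<open>Orthogonality preserving bijections of Grassmannians\<close>

locale grass_ortho =
  fixes k :: nat and g :: "'a::complex_inner set \<Rightarrow> 'a set"
  assumes dim: "cdim_greater (UNIV :: 'a set) (2 * k)" and k_pos: "1 \<le> k"
    and bij: "bij_betw g (grass k) (grass k)"
    and ortho: "X \<in> grass k \<Longrightarrow> Y \<in> grass k \<Longrightarrow> perp (g X) (g Y) \<longleftrightarrow> perp X Y"
begin

lemma g_in [simp]: "X \<in> grass k \<Longrightarrow> g X \<in> grass k"
  using bij by (auto simp: bij_betw_def)

lemma g_eq_iff: "X \<in> grass k \<Longrightarrow> Y \<in> grass k \<Longrightarrow> g X = g Y \<longleftrightarrow> X = Y"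
  using bij by (auto simp: bij_betw_def inj_on_def)

lemma g_surj:
  assumes "Y \<in> grass k"
  obtains X where "X \<in> grass k" "Y = g X"
  using assms bij by (auto simp: bij_betw_def)

text \<open>One-way results about \<open>g\<close> thereby hold for its inverse as well.\<close>

lemma inverse: "grass_ortho k (the_inv_into (grass k) g)"
proof
  let ?g = "the_inv_into (grass k) g"
  show bij': "bij_betw ?g (grass k) (grass k)" by (rule bij_betw_the_inv_into[OF bij])
  have g: "g (?g X) = X" if "X \<in> grass k" for X
    using bij that by (rule f_the_inv_into_f_bij_betw)
  show "perp (?g X) (?g Y) \<longleftrightarrow> perp X Y" if "X \<in> grass k" "Y \<in> grass k" for X Y
    using ortho[of "?g X" "?g Y"] g that bij' by (auto simp: bij_betw_def)
qed (rule dim, rule k_pos)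

text \<open>Membership of \<open>X\<close> in the double orthocomplement of \<open>{Y, Z}\<close>
  within \<open>grass k\<close>; phrased through orthogonality alone, it is preserved by
  \<open>g\<close>.\<close>

definition dperp :: "'a set \<Rightarrow> 'a set \<Rightarrow> 'a set \<Rightarrow> bool" where
  "dperp Y Z X \<longleftrightarrow> (\<forall>N\<in>grass k. perp N Y \<and> perp N Z \<longrightarrow> perp N X)"

lemma dperp_map:
  assumes "X \<in> grass k" "Y \<in> grass k" "Z \<in> grass k"
  shows "dperp (g Y) (g Z) (g X) \<longleftrightarrow> dperp Y Z X"
proof -
  have "dperp (g Y) (g Z) (g X) \<longleftrightarrow>
      (\<forall>N\<in>g ` grass k. perp N (g Y) \<and> perp N (g Z) \<longrightarrow> perp N (g X))"
    using bij by (simp add: dperp_def bij_betw_def)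
  then show ?thesis using assms ortho by (auto simp: dperp_def)
qed

text \<open>From right to left, \<open>W\<close> is the span of \<open>Y\<close> and
  \<open>Z\<close>. Conversely, a vector of \<open>X\<close> outside \<open>W\<close> would be
  separated from \<open>W\<close> by some \<open>N\<close>, which takes the full strength of
  dimension greater than \<open>2 * k\<close>.\<close>

lemma dperp_iff_subset:
  assumes X: "X \<in> grass k" and YZ: "Y \<in> grass k" "Z \<in> grass k" "Y \<noteq> Z"
    and W: "W \<in> grass (Suc k)" "Y \<subseteq> W" "Z \<subseteq> W"
  shows "dperp Y Z X \<longleftrightarrow> X \<subseteq> W"
proof
  assume "X \<subseteq> W"
  show "dperp Y Z X"
    unfolding dperp_def
  proof (intro ballI impI)
    fix N assume "perp N Y \<and> perp N Z"
    then have "perp N (complex_vector.span (Y \<union> Z))" by (simp add: perp_span_right perp_Un_right)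
    then show "perp N X"
      using grass_span_Un[OF YZ W] perp_mono \<open>X \<subseteq> W\<close> by blast
  qed
next
  assume *: "dperp Y Z X"
  show "X \<subseteq> W"
  proof (rule ccontr)
    assume "\<not> X \<subseteq> W"
    then obtain z where z: "z \<in> X" "z \<notin> W" by blast
    then obtain N where N: "N \<in> grass k" "perp N W" "\<not> perp N {z}"
      using exists_separating_grass[OF dim W(1), of z k] k_pos by auto
    then have "perp N Y" "perp N Z" using W perp_mono by blast+
    then have "perp N X" using * N(1) by (auto simp: dperp_def)
    then show False using N(3) z(1) by (auto simp: perp_def)
  qed
qed

text \<open>Two adjacent subspaces \<open>Y\<close>, \<open>Z\<close> of \<open>W\<close> determine
  it by \<open>dperp_iff_subset\<close>, but \<open>g Y\<close> and \<open>g Z\<close> are not known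
  to be adjacent. So \<open>Z\<close> is replaced by an \<open>X0\<close> such that
  \<open>Y\<close>, \<open>X0\<close> are adjacent and \<open>g Y\<close>, \<open>g X0\<close> are
  too; then that lemma applies on both sides.\<close>

lemma maps_tops_to_tops:
  fixes W :: "'a set"
  assumes W: "W \<in> grass (Suc k)"
  obtains W' where "W' \<in> grass (Suc k)" "\<And>X. X \<in> grass k \<Longrightarrow> X \<subseteq> W \<longleftrightarrow> g X \<subseteq> W'"
proof -
  obtain Y where Y: "Y \<in> grass k" "Y \<subseteq> W"
    using grass_through[OF W grass_zero[OF W] k_pos] by auto
  have "Y \<noteq> W" using grass_unique[OF Y(1), of "Suc k"] W by auto
  then obtain y where y: "y \<in> W" "y \<notin> Y" using Y by blast
  obtain Z where Z: "Z \<in> grass k" "y \<in> Z" "Z \<subseteq> W"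
    using grass_through[OF W y(1) k_pos] by auto
  have YZ: "Y \<noteq> Z" using y Z by auto
  then have "g Y \<noteq> g Z" using g_eq_iff Y Z by simp
  then obtain v where v: "v \<in> g Z" "v \<notin> g Y" using grass_eq[of "g Z" k "g Y"] Y Z by auto
  define W' where "W' = complex_vector.span (insert v (g Y))"
  have W': "W' \<in> grass (Suc k)" unfolding W'_def using v Y by (intro grass_insert) auto
  have vW': "v \<in> W'" by (simp add: W'_def complex_vector.span_base)
  \<comment> \<open>\<open>X1\<close> is adjacent to \<open>g Y\<close>, and it lies in the double
    orthocomplement of \<open>g Y\<close> and \<open>g Z\<close> because \<open>v\<close> is in
    \<open>g Z\<close>. Its preimage replaces \<open>Z\<close>.\<close>
  obtain X1 where X1: "X1 \<in> grass k" "v \<in> X1" "X1 \<subseteq> W'"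
    using grass_through[OF W' vW' k_pos] by auto
  obtain X0 where X0: "X0 \<in> grass k" "X1 = g X0" using g_surj[OF X1(1)] .
  have ne: "g Y \<noteq> X1" using X1 v by auto
  have "dperp (g Y) (g Z) X1"
    unfolding dperp_def
  proof (intro ballI impI)
    fix N assume "perp N (g Y) \<and> perp N (g Z)"
    then have "perp N (insert v (g Y))" using v by (auto simp: perp_def)
    then have "perp N W'" by (simp add: W'_def perp_span_right)
    then show "perp N X1" using X1 perp_mono by blast
  qed
  then have "dperp Y Z X0" using dperp_map[OF X0(1) Y(1) Z(1)] X0 by simp
  then have X0W: "X0 \<subseteq> W" using dperp_iff_subset[OF X0(1) Y(1) Z(1) YZ W Y(2) Z(3)] by simp
  have YW': "g Y \<subseteq> W'" unfolding W'_def by (rule span_insert_superset)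
  have X0Y: "Y \<noteq> X0" using ne X0 by auto
  show thesis
  proof (rule that[OF W'])
    fix X :: "'a set" assume X: "X \<in> grass k"
    have "X \<subseteq> W \<longleftrightarrow> dperp Y X0 X"
      using dperp_iff_subset[OF X Y(1) X0(1) X0Y W Y(2) X0W] by simp
    also have "\<dots> \<longleftrightarrow> dperp (g Y) X1 (g X)" using dperp_map[OF X Y(1) X0(1)] X0 by simp
    also have "\<dots> \<longleftrightarrow> g X \<subseteq> W'"
      using dperp_iff_subset[OF g_in[OF X] g_in[OF Y(1)] X1(1) ne W' YW' X1(3)] by simp
    finally show "X \<subseteq> W \<longleftrightarrow> g X \<subseteq> W'" .
  qed
qed

end

section \<open>Descent from dimension \<open>k + 1\<close> to dimension \<open>k\<close>\<close>

locale grass_ortho_Suc = grass_ortho "Suc k" g for k and g :: "'a::complex_inner set \<Rightarrow> 'a set"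
begin

lemma dim_2k2: "cdim_greater (UNIV :: 'a set) (2 * k + 2)"
  using dim by simp

lemma exists_not_in_grass:
  assumes "W \<in> grass m" "m \<le> 2 * k + 2"
  obtains w :: 'a where "w \<notin> W"
proof -
  obtain B where B: "finite B" "card B = m" "W = complex_vector.span B"
    using assms(1) by (auto elim: grassE)
  then have "card B \<le> 2 * k + 2" using assms(2) by simp
  then obtain w where "w \<noteq> 0" "perp {w} B"
    by (rule exists_orthogonal_vector[OF dim_2k2 B(1)])
  then have "w \<noteq> 0" "perp {w} W" by (simp_all add: B(3) perp_span_right)
  then show thesis using that[of w] perpD[of "{w}" W w w] by auto
qed

lemma g_Int:
  assumes X: "X \<in> grass (Suc k)" and Y: "Y \<in> grass (Suc k)" and "X \<noteq> Y"
    and W: "W \<in> grass (Suc (Suc k))" "X \<subseteq> W" "Y \<subseteq> W"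
  shows "g X \<inter> g Y \<in> grass k"
proof -
  obtain W' where "W' \<in> grass (Suc (Suc k))" "\<And>X. X \<in> grass (Suc k) \<Longrightarrow> X \<subseteq> W \<longleftrightarrow> g X \<subseteq> W'"
    using maps_tops_to_tops[OF W(1)] by blast
  then show ?thesis using assms g_eq_iff[OF X Y] by (intro grass_Int[of _ _ _ W']) auto
qed

text \<open>Three pairwise adjacent subspaces share their meet or lie in a common space one
  dimension larger: if the meets of \<open>g Z\<close> with \<open>g X\<close> and
  \<open>g Y\<close> differ, they span \<open>g Z\<close> inside \<open>W'\<close>, forcing
  \<open>Z \<subseteq> W\<close>.\<close>

lemma g_Int_subset:
  assumes X: "X \<in> grass (Suc k)" and Y: "Y \<in> grass (Suc k)" and XY: "X \<noteq> Y"
    and W: "W \<in> grass (Suc (Suc k))" "X \<subseteq> W" "Y \<subseteq> W"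
    and Z: "Z \<in> grass (Suc k)" "\<not> Z \<subseteq> W" "X \<inter> Y \<subseteq> Z"
  shows "g X \<inter> g Y \<subseteq> g Z"
proof -
  obtain W' where W': "W' \<in> grass (Suc (Suc k))" "\<And>X. X \<in> grass (Suc k) \<Longrightarrow> X \<subseteq> W \<longleftrightarrow> g X \<subseteq> W'"
    using maps_tops_to_tops[OF W(1)] by blast
  have S: "X \<inter> Y \<in> grass k" using grass_Int[OF X Y XY W] .
  have P: "g X \<inter> g Y \<in> grass k" using g_Int[OF X Y XY W] .
  have XZ: "X \<noteq> Z" "Y \<noteq> Z" using W Z by auto
  have sup: "A \<subseteq> complex_vector.span (A \<union> B)" "B \<subseteq> complex_vector.span (A \<union> B)" for A B :: "'a set"
    using complex_vector.span_superset[of "A \<union> B"] by auto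
  have 1: "g X \<inter> g Z \<in> grass k"
    using g_Int[OF X Z(1) XZ(1) grass_join(1)[OF S X Z(1) XZ(1) _ Z(3)]] sup by blast
  have 2: "g Y \<inter> g Z \<in> grass k"
    using g_Int[OF Y Z(1) XZ(2) grass_join(1)[OF S Y Z(1) XZ(2) _ Z(3)]] sup by blast
  show ?thesis
  proof (cases "g X \<inter> g Z = g Y \<inter> g Z")
    case True
    then have "g X \<inter> g Z = g X \<inter> g Y" by (intro grass_eq[OF 1 P]) auto
    then show ?thesis by auto
  next
    case False
    have "complex_vector.span ((g X \<inter> g Z) \<union> (g Y \<inter> g Z)) = g Z"
      using grass_span_Un[OF 1 2 False, of "g Z"] Z(1) by auto
    moreover have "complex_vector.span ((g X \<inter> g Z) \<union> (g Y \<inter> g Z)) \<subseteq> W'"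
      using W' X Y W by (intro complex_vector.span_minimal) (auto simp: grass_subspace)
    ultimately show ?thesis using W'(2)[OF Z(1)] Z(2) by auto
  qed
qed

text \<open>\<open>S\<close> is encoded by the star of all \<open>(k+1)\<close>-dimensional
  subspaces above it; \<open>p\<close> intersects the image of this star.\<close>

definition p :: "'a set \<Rightarrow> 'a set" where
  "p S = \<Inter> {g X | X. X \<in> grass (Suc k) \<and> S \<subseteq> X}"

lemma p_subset: "X \<in> grass (Suc k) \<Longrightarrow> S \<subseteq> X \<Longrightarrow> p S \<subseteq> g X"
  by (auto simp: p_def)

text \<open>Take \<open>X\<close> and \<open>Y\<close> meeting in \<open>S\<close>, with join
  \<open>W\<close>. By \<open>g_Int_subset\<close>, \<open>g X \<inter> g Y\<close> lies in
  \<open>g Z\<close> for every \<open>Z\<close> above \<open>S\<close> that is not inside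
  \<open>W\<close>; the \<open>Z\<close> inside \<open>W\<close> call for a second pair.\<close>

lemma p_eq_Int:
  assumes S: "S \<in> grass k"
  obtains X Y where "X \<in> grass (Suc k)" "Y \<in> grass (Suc k)" "X \<inter> Y = S" "p S = g X \<inter> g Y"
    "p S \<in> grass k"
proof -
  obtain x where x: "x \<notin> S" using exists_not_in_grass[OF S] by auto
  define X where "X = complex_vector.span (insert x S)"
  have X: "X \<in> grass (Suc k)" "S \<subseteq> X"
    unfolding X_def by (rule grass_insert[OF S x], rule span_insert_superset)
  obtain y where y: "y \<notin> X" using exists_not_in_grass[OF X(1)] by auto
  define Y where "Y = complex_vector.span (insert y S)"
  have "y \<notin> S" using X y by auto
  then have Y: "Y \<in> grass (Suc k)" "S \<subseteq> Y" "y \<in> Y"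
    unfolding Y_def by (simp_all add: grass_insert[OF S] span_insert_superset in_span_insert)
  have XY: "X \<noteq> Y" using y Y by auto
  define W where "W = complex_vector.span (X \<union> Y)"
  have W: "W \<in> grass (Suc (Suc k))" "X \<subseteq> W" "Y \<subseteq> W"
    unfolding W_def using grass_join(1)[OF S X(1) Y(1) XY X(2) Y(2)]
      complex_vector.span_superset[of "X \<union> Y"] by auto
  have S_eq: "X \<inter> Y = S" using grass_join(2)[OF S X(1) Y(1) XY X(2) Y(2)] .
  \<comment> \<open>The second pair: \<open>Y'\<close> above \<open>S\<close> leaves
    \<open>W\<close>, so \<open>X\<close> and \<open>Y'\<close> have another join \<open>V\<close>
    but, as shown below, the same meet of images.\<close>
  obtain w where w: "w \<notin> W" using exists_not_in_grass[OF W(1)] by auto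
  define Y' where "Y' = complex_vector.span (insert w S)"
  have "w \<notin> S" using X W w by auto
  then have Y': "Y' \<in> grass (Suc k)" "S \<subseteq> Y'" "w \<in> Y'"
    unfolding Y'_def by (simp_all add: grass_insert[OF S] span_insert_superset in_span_insert)
  have XY': "X \<noteq> Y'" using w Y' W by auto
  define V where "V = complex_vector.span (X \<union> Y')"
  have V: "V \<in> grass (Suc (Suc k))" "X \<subseteq> V" "Y' \<subseteq> V"
    unfolding V_def using grass_join(1)[OF S X(1) Y'(1) XY' X(2) Y'(2)]
      complex_vector.span_superset[of "X \<union> Y'"] by auto
  have S_eq': "X \<inter> Y' = S" using grass_join(2)[OF S X(1) Y'(1) XY' X(2) Y'(2)] .
  have P: "g X \<inter> g Y \<in> grass k" using g_Int[OF X(1) Y(1) XY W] .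
  have P': "g X \<inter> g Y' \<in> grass k" using g_Int[OF X(1) Y'(1) XY' V] .
  have "g X \<inter> g Y \<subseteq> g Y'"
    using g_Int_subset[OF X(1) Y(1) XY W Y'(1)] S_eq Y' w by auto
  then have PP': "g X \<inter> g Y = g X \<inter> g Y'" by (intro grass_eq[OF P P']) auto
  have sub: "g X \<inter> g Y \<subseteq> g Z" if Z: "Z \<in> grass (Suc k)" "S \<subseteq> Z" for Z
  proof (cases "Z \<subseteq> W")
    case False
    then show ?thesis using g_Int_subset[OF X(1) Y(1) XY W Z(1)] S_eq Z by auto
  next
    case True
    show ?thesis
    proof (cases "Z = X")
      case False
      \<comment> \<open>Distinct \<open>Z\<close> and \<open>X\<close> span every
        \<open>(k+2)\<close>-dimensional space containing both, so \<open>Z\<close> cannot lie in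
        both \<open>W\<close> and \<open>V\<close>.\<close>
      have "\<not> Z \<subseteq> V"
      proof
        assume ZV: "Z \<subseteq> V"
        then have "W = V"
          using grass_span_Un[OF Z(1) X(1) False W(1) True W(2)]
            grass_span_Un[OF Z(1) X(1) False V(1) ZV V(2)] by simp
        then show False using w Y' V by auto
      qed
      then show ?thesis using g_Int_subset[OF X(1) Y'(1) XY' V Z(1)] S_eq' Z PP' by auto
    qed auto
  qed
  have "p S = g X \<inter> g Y"
    using sub X Y by (auto simp: p_def)
  then show thesis using that[OF X(1) Y(1) S_eq] P by simp
qed

lemma p_in: "S \<in> grass k \<Longrightarrow> p S \<in> grass k"
  by (erule p_eq_Int) simp

text \<open>New vectors \<open>u\<close> and \<open>v\<close>, orthogonal to each other and to
  \<open>S\<close> and \<open>T\<close>, extend \<open>S\<close> and \<open>T\<close> to orthogonal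
  \<open>X\<close> and \<open>Y\<close>; then \<open>g X\<close> and \<open>g Y\<close> are
  orthogonal and contain \<open>p S\<close> and \<open>p T\<close>.\<close>

lemma p_perp:
  assumes S: "S \<in> grass k" and T: "T \<in> grass k" and ST: "perp S T"
  shows "perp (p S) (p T)"
proof -
  obtain B where B: "finite B" "card B = k" "S = complex_vector.span B"
    using S by (auto elim: grassE)
  obtain D where D: "finite D" "card D = k" "T = complex_vector.span D"
    using T by (auto elim: grassE)
  have card: "finite (B \<union> D)" "card (B \<union> D) \<le> 2 * k" using card_Un_le[of B D] B D by simp_all
  then obtain u where u: "u \<noteq> 0" "perp {u} (B \<union> D)"
    using exists_orthogonal_vector[OF dim_2k2 card(1)] trans_le_add1 by blast
  then have uST: "perp {u} S" "perp {u} T" by (auto simp: B(3) D(3) perp_span_right perp_Un_right)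
  have "finite (insert u (B \<union> D))" "card (insert u (B \<union> D)) \<le> 2 * k + 2"
    using card by (auto simp: card_insert_if)
  then obtain v where v: "v \<noteq> 0" "perp {v} (insert u (B \<union> D))"
    by (rule exists_orthogonal_vector[OF dim_2k2])
  then have vu: "cinner v u = 0" and "perp {v} (B \<union> D)" by (auto simp: perp_def)
  then have vST: "perp {v} S" "perp {v} T" by (auto simp: B(3) D(3) perp_span_right perp_Un_right)
  have nin: "u \<notin> S" "v \<notin> T"
    using u(1) v(1) perpD[OF uST(1), of u u] perpD[OF vST(2), of v v] by auto
  define X where "X = complex_vector.span (insert u S)"
  define Y where "Y = complex_vector.span (insert v T)"
  have XY: "X \<in> grass (Suc k)" "Y \<in> grass (Suc k)"
    unfolding X_def Y_def using S T nin by (auto intro: grass_insert)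
  have "cinner u v = 0" "perp S {v}"
    using vu vST(1) cinner_eq_0_commute perp_commute by blast+
  then have "perp X Y"
    unfolding X_def Y_def perp_span_left perp_span_right
    using ST uST by (simp add: perp_def)
  then have "perp (g X) (g Y)" using ortho XY by simp
  moreover have "S \<subseteq> X" "T \<subseteq> Y" unfolding X_def Y_def by (rule span_insert_superset)+
  ultimately show ?thesis using p_subset XY perp_mono by metis
qed

text \<open>The inverse of \<open>g\<close> induces its own map \<open>inv.p\<close>, which gives
  bijectivity of \<open>p\<close> and the reverse implication for orthogonality.\<close>

interpretation inv: grass_ortho_Suc k "the_inv_into (grass (Suc k)) g"
  unfolding grass_ortho_Suc_def by (rule inverse)

text \<open>With \<open>S = X \<inter> Y\<close>, \<open>p S\<close> lies in \<open>g X\<close> and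
  \<open>g Y\<close>, so \<open>inv.p (p S)\<close> lies in \<open>X\<close> and in
  \<open>Y\<close>; dimension gives equality.\<close>

lemma inv_p_p:
  assumes S: "S \<in> grass k"
  shows "inv.p (p S) = S"
proof -
  obtain X Y where XY: "X \<in> grass (Suc k)" "Y \<in> grass (Suc k)" "X \<inter> Y = S" "p S = g X \<inter> g Y"
    "p S \<in> grass k"
    by (rule p_eq_Int[OF S])
  have inv: "the_inv_into (grass (Suc k)) g (g Z) = Z" if "Z \<in> grass (Suc k)" for Z
    using bij that by (simp add: bij_betw_def the_inv_into_f_f)
  have "inv.p (p S) \<subseteq> X"
    using inv.p_subset[of "g X" "p S"] XY inv by auto
  moreover have "inv.p (p S) \<subseteq> Y"
    using inv.p_subset[of "g Y" "p S"] XY inv by auto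
  ultimately show ?thesis
    using grass_eq[OF inv.p_in[OF p_in[OF S]] S] XY by blast
qed

lemma p_inv_p:
  assumes S: "S \<in> grass k"
  shows "p (inv.p S) = S"
proof -
  obtain X Y where XY: "X \<in> grass (Suc k)" "Y \<in> grass (Suc k)" "X \<inter> Y = S"
    "inv.p S = the_inv_into (grass (Suc k)) g X \<inter> the_inv_into (grass (Suc k)) g Y"
    "inv.p S \<in> grass k"
    by (rule inv.p_eq_Int[OF S])
  have g: "g (the_inv_into (grass (Suc k)) g Z) = Z" if "Z \<in> grass (Suc k)" for Z
    using f_the_inv_into_f_bij_betw[OF bij that] .
  have "p (inv.p S) \<subseteq> X"
    using p_subset[of "the_inv_into (grass (Suc k)) g X" "inv.p S"] XY g by auto
  moreover have "p (inv.p S) \<subseteq> Y"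
    using p_subset[of "the_inv_into (grass (Suc k)) g Y" "inv.p S"] XY g by auto
  ultimately show ?thesis
    using grass_eq[OF p_in[OF inv.p_in[OF S]] S] XY by blast
qed

lemma grass_ortho_p: "1 \<le> k \<Longrightarrow> grass_ortho k p"
proof
  show "bij_betw p (grass k) (grass k)"
    by (rule bij_betw_byWitness[where f' = inv.p]) (auto simp: inv_p_p p_inv_p p_in inv.p_in)
  show "perp (p X) (p Y) \<longleftrightarrow> perp X Y" if "X \<in> grass k" "Y \<in> grass k" for X Y
    using p_perp[OF that] inv.p_perp[OF p_in[OF that(1)] p_in[OF that(2)]] that by (auto simp: inv_p_p)
  show "cdim_greater (UNIV :: 'a set) (2 * k)" using cdim_greater_mono[OF dim_2k2] by simp
qed

text \<open>As \<open>k\<close> is positive, \<open>X\<close> and \<open>g X\<close> are the unions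
  of their \<open>k\<close>-dimensional subspaces, and \<open>p\<close> and \<open>inv.p\<close>
  match the two families.\<close>

lemma induced_from_p:
  assumes U: "\<And>S. S \<in> grass k \<Longrightarrow> p S = U ` S" and k: "1 \<le> k" and X: "X \<in> grass (Suc k)"
  shows "g X = U ` X"
proof
  show "U ` X \<subseteq> g X"
  proof
    fix y assume "y \<in> U ` X"
    then obtain x where x: "x \<in> X" "y = U x" by blast
    obtain S where "S \<in> grass k" "x \<in> S" "S \<subseteq> X" using grass_through[OF X x(1) k] by auto
    then show "y \<in> g X" using U[of S] p_subset[OF X, of S] x by auto
  qed
  show "g X \<subseteq> U ` X"
  proof
    fix y assume y: "y \<in> g X"
    have gX: "g X \<in> grass (Suc k)" using X by simp
    obtain S where S: "S \<in> grass k" "y \<in> S" "S \<subseteq> g X" using grass_through[OF gX y k] by auto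
    have "inv.p S \<subseteq> X"
      using inv.p_subset[OF gX S(3)] bij X by (simp add: bij_betw_def the_inv_into_f_f)
    moreover have "S = U ` inv.p S" using U[OF inv.p_in[OF S(1)]] p_inv_p[OF S(1)] by simp
    ultimately show "y \<in> U ` X" using S(2) by (metis image_mono subsetD)
  qed
qed

end

section \<open>Lines as the base case, and induction on the dimension\<close>

lemma semiunitary_image_span:
  assumes "semiunitary s U" "surj s"
  shows "U ` complex_vector.span {x} = complex_vector.span {U x}"
proof -
  have "U ` range (\<lambda>c. c *\<^sub>C x) = (\<lambda>c. s c *\<^sub>C U x) ` UNIV"
    using assms(1) by (simp add: semiunitary_def image_image)
  also have "\<dots> = (\<lambda>c. c *\<^sub>C U x) ` range s" by (simp add: image_image)
  finally show ?thesis using assms(2) by (simp add: complex_vector.span_singleton)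
qed

lemma unitary_or_antiunitary_image_span:
  assumes "unitary U \<or> antiunitary U"
  shows "U ` complex_vector.span {x} = complex_vector.span {U x}"
proof -
  have "surj cnj" by (metis complex_cnj_cnj surjI)
  then show ?thesis
    using assms semiunitary_image_span[of id U x] semiunitary_image_span[of cnj U x]
    by (auto simp: unitary_iff_semiunitary antiunitary_iff_semiunitary)
qed

lemma grass_ortho_1_induced:
  fixes g :: "'a::complex_inner set \<Rightarrow> 'a set"
  assumes "grass_ortho 1 g"
  shows "\<exists>U. (unitary U \<or> antiunitary U) \<and> (\<forall>X\<in>grass 1. g X = U ` X)"
proof -
  interpret grass_ortho 1 g by fact
  \<comment> \<open>A representative of the image line; \<open>ortho_map\<close> forces the value 0
    at 0.\<close>
  define h where "h x = (if x = 0 then 0 else SOME y. y \<in> g (complex_vector.span {x}) \<and> y \<noteq> 0)" for x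
  have h: "h x \<noteq> 0" "g (complex_vector.span {x}) = complex_vector.span {h x}" if "x \<noteq> 0" for x
  proof -
    have G: "g (complex_vector.span {x}) \<in> grass 1"
      by (rule g_in[OF span_singleton_in_grass[OF that]])
    then have "\<exists>y. y \<in> g (complex_vector.span {x}) \<and> y \<noteq> 0" by (blast elim: grass_1_nonzero)
    then have "h x \<in> g (complex_vector.span {x}) \<and> h x \<noteq> 0"
      using that someI_ex[of "\<lambda>y. y \<in> g (complex_vector.span {x}) \<and> y \<noteq> 0"] by (simp add: h_def)
    then show "h x \<noteq> 0" "g (complex_vector.span {x}) = complex_vector.span {h x}"
      using grass_1_eq_span[OF G] by auto
  qed
  have sp: "perp (complex_vector.span {x}) (complex_vector.span {y}) \<longleftrightarrow> cinner x y = 0" for x y :: 'a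
    unfolding perp_span_left perp_span_right by (simp add: perp_def)
  interpret H: ortho_map h
  proof
    show "cdim_greater (UNIV :: 'a set) 2" using dim by simp
    show "cinner (h x) (h y) = 0 \<longleftrightarrow> cinner x y = 0" for x y
    proof (cases "x = 0 \<or> y = 0")
      case False
      then show ?thesis
        using ortho[OF span_singleton_in_grass span_singleton_in_grass, of x y] by (simp add: h sp)
    qed (auto simp: h_def)
    show "\<exists>x c. y = c *\<^sub>C h x" for y
    proof (cases "y = 0")
      case True
      then show ?thesis by (auto intro!: exI[of _ 0])
    next
      case False
      obtain X where X: "X \<in> grass 1" "complex_vector.span {y} = g X"
        using g_surj[OF span_singleton_in_grass[OF False]] by blast
      obtain x where x: "x \<in> X" "x \<noteq> 0" using grass_1_nonzero[OF X(1)] .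
      have "complex_vector.span {y} = complex_vector.span {h x}"
        using X x grass_1_eq_span h by metis
      then have "y \<in> complex_vector.span {h x}" using complex_vector.span_base[of y "{y}"] by simp
      then show ?thesis by (auto simp: complex_vector.span_singleton)
    qed
  qed
  obtain U where U: "unitary U \<or> antiunitary U" "\<And>x. \<exists>c. h x = c *\<^sub>C U x"
    using H.induced_by_unitary_or_antiunitary by blast
  have "g X = U ` X" if X: "X \<in> grass 1" for X
  proof -
    obtain x where x: "x \<in> X" "x \<noteq> 0" using grass_1_nonzero[OF X] .
    then have X_eq: "X = complex_vector.span {x}" using grass_1_eq_span[OF X] by simp
    obtain c where c: "h x = c *\<^sub>C U x" using U by blast
    then have "U x \<noteq> 0" using h(1) x(2) by force
    have "h x \<in> complex_vector.span {U x}" using c by (simp add: complex_vector.span_base complex_vector.span_scale)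
    then have "complex_vector.span {U x} = complex_vector.span {h x}"
      using grass_1_eq_span[OF span_singleton_in_grass[OF \<open>U x \<noteq> 0\<close>]] h(1)[OF x(2)] by blast
    then show ?thesis
      using h(2)[OF x(2)] unitary_or_antiunitary_image_span[OF U(1)] X_eq by simp
  qed
  then show ?thesis using U(1) by blast
qed

theorem grass_ortho_induced:
  fixes g :: "'a::complex_inner set \<Rightarrow> 'a set"
  assumes "1 \<le> k" "grass_ortho k g"
  shows "\<exists>U. (unitary U \<or> antiunitary U) \<and> (\<forall>X\<in>grass k. g X = U ` X)"
  using assms
proof (induction k arbitrary: g rule: dec_induct)
  case base
  then show ?case by (rule grass_ortho_1_induced)
next
  case (step k)
  interpret grass_ortho_Suc k g using step.prems by (simp add: grass_ortho_Suc_def)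
  obtain U where U: "unitary U \<or> antiunitary U" "\<And>S. S \<in> grass k \<Longrightarrow> p S = U ` S"
    using step.IH[OF grass_ortho_p[OF step.hyps(1)]] by blast
  then show ?case using induced_from_p[OF U(2) step.hyps(1)] by blast
qed

section \<open>Transitivity of the unitary group on Grassmannians\<close>

text \<open>The reflection in the hyperplane orthogonal to \<open>v\<close>; for
  \<open>v = 0\<close> division by zero makes it the identity.\<close>

definition householder :: "'a::complex_inner \<Rightarrow> 'a \<Rightarrow> 'a" where
  "householder v z = z - (2 * cinner z v / cinner v v) *\<^sub>C v"

lemma cnj_cinner: "cnj (cinner x y) = cinner y x"
  using cinner_commute by metis

lemma unitary_householder: "unitary (householder v)"
proof (cases "v = 0")
  case True
  then have "householder v = id" by (auto simp: householder_def)
  then show ?thesis by (simp add: unitary_iff_semiunitary semiunitary_def)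
next
  case False
  then have n: "cinner v v \<noteq> 0" by simp
  have add: "householder v (x + y) = householder v x + householder v y" for x y
    by (simp add: householder_def cinner_simps add_divide_distrib distrib_left scaleC_add_left)
  have scale: "householder v (c *\<^sub>C x) = c *\<^sub>C householder v x" for c x
    by (simp add: householder_def cinner_simps complex_vector.scale_right_diff_distrib scaleC_scaleC)
  have "cinner (householder v x) v = - cinner x v" for x
    using n by (simp add: householder_def cinner_simps)
  then have "householder v (householder v x) = x" for x
    unfolding householder_def[of v "householder v x"] by (simp add: householder_def)
  then have "bij (householder v)" by (metis bijI')
  moreover have "cinner (householder v x) (householder v y) = cinner x y" for x y
    using n by (simp add: householder_def cinner_simps cnj_cinner field_simps)
  ultimately show ?thesis
    by (auto simp: unitary_iff_semiunitary semiunitary_def add scale)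
qed

text \<open>Multiplying \<open>y\<close> by a phase makes \<open>\<langle>x, y\<rangle>\<close> real, and then the reflection along \<open>x - y\<close>
  swaps \<open>x\<close> and \<open>y\<close>.\<close>

lemma exists_unitary_moving_vector:
  assumes "cinner x x = 1" "cinner y y = 1"
  obtains R c where "unitary R" "R x = c *\<^sub>C y" "\<And>z. cinner z x = 0 \<Longrightarrow> cinner z y = 0 \<Longrightarrow> R z = z"
proof -
  \<comment> \<open>\<open>sgn\<close> is 0 at 0, so a vanishing inner product gets the phase 1
    instead.\<close>
  define c where "c = (if cinner x y = 0 then 1 else sgn (cinner x y))"
  define v where "v = x - c *\<^sub>C y"
  have cc: "c * cnj c = 1"
    by (simp add: c_def complex_norm_square[symmetric] norm_sgn)
  have "cnj c * cinner x y = of_real (cmod (cinner x y))"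
    by (auto simp: c_def sgn_eq complex_norm_square[symmetric] mult.commute power2_eq_square)
  then have a: "cnj c * cinner x y \<in> \<real>" by simp
  then have b: "c * cinner y x = cnj c * cinner x y"
    by (metis Reals_cnj_iff cnj_cinner complex_cnj_cnj complex_cnj_mult)
  \<comment> \<open>For nonzero \<open>v\<close> this makes the factor in
    \<open>householder v x\<close> equal to 1, so that exactly \<open>v\<close> is
    subtracted.\<close>
  have vv: "cinner v v = 2 * cinner x v"
    using assms cc b by (simp add: v_def cinner_simps algebra_simps)
  have "householder v x = x - v"
    using vv by (cases "v = 0") (auto simp: householder_def)
  then have "householder v x = c *\<^sub>C y" by (simp add: v_def)
  moreover have "householder v z = z" if "cinner z x = 0" "cinner z y = 0" for z
    using that by (simp add: householder_def v_def cinner_simps)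
  ultimately show thesis using that unitary_householder by blast
qed

text \<open>One Gram-Schmidt step: a vector of \<open>X\<close> outside a hyperplane
  \<open>X0\<close> loses its component in \<open>X0\<close> and is normalised.\<close>

lemma grass_orthogonal_split:
  assumes "X \<in> grass (Suc k)"
  obtains X0 x where "X0 \<in> grass k" "cinner x x = 1" "perp {x} X0"
    "X = complex_vector.span (insert x X0)"
proof -
  have zero: "{0} \<in> grass 0" by (simp add: grass_0)
  obtain X0 where X0: "X0 \<in> grass k" "{0} \<subseteq> X0" "X0 \<subseteq> X"
    by (rule grass_between[OF le0 zero assms grass_0_subset[OF assms] le_SucI[OF le_refl]])
  obtain B where B: "finite B" "X0 = complex_vector.span B" using X0(1) by (auto elim: grassE)
  have "X0 \<noteq> X" using grass_unique[OF X0(1), of "Suc k"] assms by auto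
  then obtain z where z: "z \<in> X" "z \<notin> X0" using X0 by blast
  obtain w u where wu: "z = w + u" "w \<in> X0" "perp {u} X0"
    using exists_orthogonal_decomposition[OF B(1)] B(2) by blast
  have "u \<noteq> 0" using z wu by auto
  then obtain c where c: "cinner (c *\<^sub>C u) (c *\<^sub>C u) = 1" by (metis exists_unit_multiple)
  have "w \<in> X" using wu(2) X0(3) by blast
  then have "z - w \<in> X" using z(1) assms by (simp add: grass_subspace complex_vector.subspace_diff)
  then have cu: "c *\<^sub>C u \<in> X" using wu(1) assms by (simp add: grass_subspace complex_vector.subspace_scale)
  have p: "perp {c *\<^sub>C u} X0" using wu(3) by (simp add: perp_def cinner_simps)
  then have nin: "c *\<^sub>C u \<notin> X0" using c perpD[OF p, of "c *\<^sub>C u" "c *\<^sub>C u"] by auto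
  have "X = complex_vector.span (insert (c *\<^sub>C u) X0)"
    using grass_eq[OF grass_insert[OF X0(1) nin] assms span_insert_subset[OF assms X0(3) cu]] by simp
  then show thesis using that[OF X0(1) c p] by blast
qed

lemma unitary_image_span:
  "unitary U \<Longrightarrow> U ` complex_vector.span S = complex_vector.span (U ` S)"
  unfolding unitary_def using module_hom.span_image[OF Vector_Spaces.linear.axioms(3)] by metis

lemma unitary_comp: "unitary U \<Longrightarrow> unitary V \<Longrightarrow> unitary (U \<circ> V)"
  by (simp add: unitary_iff_semiunitary semiunitary_def bij_comp)

lemma unitary_id: "unitary id"
  by (simp add: unitary_iff_semiunitary semiunitary_def)

text \<open>By induction some \<open>V\<close> takes the hyperplane \<open>X0\<close> to
  \<open>Y0\<close>. An \<open>R\<close> then turns \<open>V x\<close> into a multiple of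
  \<open>y\<close>; it fixes \<open>Y0\<close> pointwise, since \<open>Y0\<close> is orthogonal to
  both \<open>V x\<close> and \<open>y\<close>.\<close>

lemma unitary_transitive_on_grass:
  "X \<in> grass k \<Longrightarrow> Y \<in> grass k \<Longrightarrow> \<exists>U. unitary U \<and> U ` X = Y"
proof (induction k arbitrary: X Y)
  case 0
  then show ?case using unitary_id by (auto simp: grass_0 intro!: exI[of _ id])
next
  case (Suc k)
  obtain X0 x where X: "X0 \<in> grass k" "cinner x x = 1" "perp {x} X0"
    "X = complex_vector.span (insert x X0)"
    using grass_orthogonal_split[OF Suc.prems(1)] .
  obtain Y0 y where Y: "Y0 \<in> grass k" "cinner y y = 1" "perp {y} Y0"
    "Y = complex_vector.span (insert y Y0)"
    using grass_orthogonal_split[OF Suc.prems(2)] .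
  obtain V where V: "unitary V" "V ` X0 = Y0" using Suc.IH[OF X(1) Y(1)] by blast
  have "cinner (V x) (V x) = 1" using V X by (simp add: unitary_def)
  then obtain R c where R: "unitary R" "R (V x) = c *\<^sub>C y"
    "\<And>z. cinner z (V x) = 0 \<Longrightarrow> cinner z y = 0 \<Longrightarrow> R z = z"
    using exists_unitary_moving_vector[OF _ Y(2)] by metis
  have "R z = z" if z: "z \<in> Y0" for z
  proof (rule R(3))
    obtain z' where z': "z' \<in> X0" "z = V z'" using z V by blast
    then show "cinner z (V x) = 0"
      using V(1) perpD[OF X(3), of x z'] cinner_eq_0_commute[of x z'] by (simp add: unitary_def)
    show "cinner z y = 0" using perpD[OF Y(3), of y z] z cinner_eq_0_commute[of y z] by simp
  qed
  then have RY: "R ` Y0 = Y0" by simp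
  have "(R \<circ> V) ` insert x X0 = R ` V ` insert x X0" by (rule image_comp[symmetric])
  also have "\<dots> = insert (c *\<^sub>C y) Y0" by (simp only: image_insert V(2) R(2) RY)
  finally have UX: "(R \<circ> V) ` X = complex_vector.span (insert (c *\<^sub>C y) Y0)"
    unfolding X(4) unitary_image_span[OF unitary_comp[OF R(1) V(1)]] by simp
  have "cinner (c *\<^sub>C y) (c *\<^sub>C y) = 1"
    using R(1) V(1) X(2) unfolding R(2)[symmetric] by (simp add: unitary_def)
  then have "c *\<^sub>C y \<notin> Y0"
    using Y(3) perpD[of "{c *\<^sub>C y}" Y0 "c *\<^sub>C y" "c *\<^sub>C y"] by (auto simp: perp_def cinner_simps)
  moreover have "c *\<^sub>C y \<in> Y" "Y0 \<subseteq> Y"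
    using Y(4) complex_vector.span_superset[of "insert y Y0"] by (auto intro: complex_vector.span_scale)
  ultimately have "(R \<circ> V) ` X = Y"
    unfolding UX using grass_eq[OF grass_insert[OF Y(1)] Suc.prems(2)] span_insert_subset[OF Suc.prems(2)]
    by blast
  then show ?case using unitary_comp R V by blast
qed

section \<open>Conjugacy classes\<close>

text \<open>\<open>cadjoint\<close> is a choice, so \<open>inv U\<close> has to be shown to be the
  only adjoint.\<close>

lemma cadjoint_unitary:
  assumes "unitary U"
  shows "cadjoint U = inv U"
proof -
  have "is_cadjoint U B \<longleftrightarrow> B = inv U" for B
  proof
    have U: "cinner (U x) y = cinner x (inv U y)" for x y
      using assms by (metis unitary_def bij_inv_eq_iff)
    then show "B = inv U \<Longrightarrow> is_cadjoint U B" by (simp add: is_cadjoint_def)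
    assume "is_cadjoint U B"
    then have "cinner x (B y) = cinner x (inv U y)" for x y using U by (simp add: is_cadjoint_def)
    then have "B y = inv U y" for y by (metis cinner_ext cinner_commute)
    then show "B = inv U" by blast
  qed
  then show ?thesis by (simp add: cadjoint_def)
qed

lemma conj_selfadjoint:
  assumes "unitary U" "is_cadjoint A A"
  shows "is_cadjoint (U \<circ> A \<circ> inv U) (U \<circ> A \<circ> inv U)"
proof -
  have "cinner (U x) y = cinner x (inv U y)" "cinner y (U x) = cinner (inv U y) x" for x y
    using assms(1) by (metis unitary_def bij_inv_eq_iff)+
  then show ?thesis using assms(2) by (simp add: is_cadjoint_def)
qed

lemma range_conj:
  assumes "unitary U"
  shows "range (U \<circ> A \<circ> inv U) = U ` range A"
proof -
  have "surj (inv U)" using assms by (simp add: unitary_def bij_imp_bij_inv bij_is_surj)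
  then show ?thesis by (metis image_comp)
qed

text \<open>A self-adjoint factor moves across the inner product,
  \<open>cinner (A (B x)) y = cinner (B x) (A y)\<close>, so vanishing products mean orthogonal
  images.\<close>

lemma orthogonal_ops_iff_perp:
  assumes "is_cadjoint A A" "is_cadjoint B B"
  shows "orthogonal_ops A B \<longleftrightarrow> perp (range A) (range B)"
proof -
  have comp: "P \<circ> Q = (\<lambda>_. 0) \<longleftrightarrow> perp (range Q) (range P)"
    if "is_cadjoint P P" for P Q :: "'a \<Rightarrow> 'a"
  proof -
    have "P \<circ> Q = (\<lambda>_. 0) \<longleftrightarrow> (\<forall>x y. cinner (P (Q x)) y = 0)"
      by (auto simp: fun_eq_iff intro: cinner_ext)
    then show ?thesis using that by (auto simp: is_cadjoint_def perp_def)
  qed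
  show ?thesis
    using comp[OF assms(1), of B] comp[OF assms(2), of A] perp_commute
    by (auto simp: orthogonal_ops_def)
qed

lemma finite_dim_subspace_in_grass:
  assumes "cfinite_dim S" "complex_vector.subspace S"
  shows "S \<in> grass (complex_vector.dim S)"
proof -
  obtain B where B: "finite B" "S \<subseteq> complex_vector.span B"
    using assms(1) by (auto simp: cfinite_dim_def)
  obtain D where D: "D \<subseteq> S" "complex_vector.independent D" "S \<subseteq> complex_vector.span D"
    "card D = complex_vector.dim S"
    using complex_vector.basis_exists by blast
  have "finite D"
    using complex_vector.independent_span_bound[OF B(1) D(2)] B D by auto
  moreover have "S = complex_vector.span D"
    using D assms(2) by (simp add: complex_vector.span_minimal subset_antisym)
  ultimately show ?thesis using D by (metis grassI)
qed

section \<open>A conjugacy class seen through the images of its members\<close>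

locale op_class =
  fixes C :: "('a::complex_inner \<Rightarrow> 'a) set" and k :: nat
  assumes conj_class: "conjugacy_class C" and rank: "A \<in> C \<Longrightarrow> crank A = k"
begin

lemma class_repr:
  obtains A where "A \<in> finite_rank_selfadjoint" "C = {U \<circ> A \<circ> inv U | U. unitary U}"
proof -
  obtain A where A: "A \<in> finite_rank_selfadjoint" "C = {U \<circ> A \<circ> cadjoint U | U. unitary U}"
    using conj_class unfolding conjugacy_class_def by blast
  have "(\<exists>U. B = U \<circ> A \<circ> cadjoint U \<and> unitary U) \<longleftrightarrow> (\<exists>U. B = U \<circ> A \<circ> inv U \<and> unitary U)" for B
    by (rule ex_cong1) (simp add: cadjoint_unitary cong: conj_cong rev_conj_cong)
  then show thesis using that[OF A(1)] A(2) by simp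
qed

lemma selfadjoint: "A \<in> C \<Longrightarrow> is_cadjoint A A"
  by (rule class_repr) (auto simp: finite_rank_selfadjoint_def intro: conj_selfadjoint)

lemma orthogonal_iff: "A \<in> C \<Longrightarrow> B \<in> C \<Longrightarrow> orthogonal_ops A B \<longleftrightarrow> perp (range A) (range B)"
  using orthogonal_ops_iff_perp selfadjoint by blast

lemma range_in_grass:
  assumes "A \<in> C"
  shows "range A \<in> grass k"
proof -
  obtain A0 where A0: "A0 \<in> finite_rank_selfadjoint" "C = {U \<circ> A0 \<circ> inv U | U. unitary U}"
    by (rule class_repr)
  then obtain U where U: "unitary U" "A = U \<circ> A0 \<circ> inv U" using assms by blast
  have lin: "Vector_Spaces.linear scaleC scaleC A0" "Vector_Spaces.linear scaleC scaleC U"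
    using A0 U by (auto simp: finite_rank_selfadjoint_def bounded_clinear_def unitary_def)
  have "complex_vector.subspace (range A0)"
    using module_hom.subspace_image[OF Vector_Spaces.linear.axioms(3)[OF lin(1)]] by simp
  then have "complex_vector.subspace (U ` range A0)"
    using module_hom.subspace_image[OF Vector_Spaces.linear.axioms(3)[OF lin(2)]] by simp
  moreover have "cfinite_dim (U ` range A0)"
  proof -
    obtain B where "finite B" "range A0 \<subseteq> complex_vector.span B"
      using A0 by (auto simp: finite_rank_selfadjoint_def cfinite_dim_def)
    then have "finite (U ` B)" "U ` range A0 \<subseteq> complex_vector.span (U ` B)"
      using unitary_image_span[OF U(1)] by blast+
    then show ?thesis unfolding cfinite_dim_def by blast
  qed
  moreover have "range A = U ` range A0" using U range_conj by simp
  ultimately show ?thesis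
    using finite_dim_subspace_in_grass[of "range A"] rank[OF assms] by (simp add: crank_def)
qed

text \<open>Conjugating \<open>A0\<close> by \<open>U\<close> moves its image by \<open>U\<close>,
  and unitaries act transitively on \<open>grass k\<close>.\<close>

lemma range_surj:
  assumes "X \<in> grass k"
  obtains A where "A \<in> C" "range A = X"
proof -
  obtain A0 where A0: "C = {U \<circ> A0 \<circ> inv U | U. unitary U}"
    by (rule class_repr)
  then have "id \<circ> A0 \<circ> inv id \<in> C" using unitary_id by blast
  then have "A0 \<in> C" by (simp add: inv_id)
  then obtain U where "unitary U" "U ` range A0 = X"
    using unitary_transitive_on_grass range_in_grass assms by blast
  then show thesis using that[of "U \<circ> A0 \<circ> inv U"] A0 range_conj by blast
qed

text \<open>Expresses equality of images by orthogonality within the class, which \<open>f\<close>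
  preserves. A vector of one image outside the other is detected by a separating subspace, itself
  the image of a member.\<close>

lemma range_eq_iff:
  assumes dim: "cdim_greater (UNIV :: 'a set) (2 * k)" and k: "1 \<le> k" and AB: "A \<in> C" "B \<in> C"
  shows "range A = range B \<longleftrightarrow> (\<forall>D\<in>C. orthogonal_ops D A \<longleftrightarrow> orthogonal_ops D B)"
proof
  assume "range A = range B"
  then show "\<forall>D\<in>C. orthogonal_ops D A \<longleftrightarrow> orthogonal_ops D B" using AB by (simp add: orthogonal_iff)
next
  assume *: "\<forall>D\<in>C. orthogonal_ops D A \<longleftrightarrow> orthogonal_ops D B"
  have "range A \<subseteq> range B"
  proof (rule ccontr)
    assume "\<not> range A \<subseteq> range B"
    then obtain z where z: "z \<in> range A" "z \<notin> range B" by blast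
    obtain N where N: "N \<in> grass k" "perp N (range B)" "\<not> perp N {z}"
      using exists_separating_grass[OF dim range_in_grass[OF AB(2)] z(2) _ k] by auto
    obtain D where D: "D \<in> C" "range D = N" using range_surj[OF N(1)] .
    then have "perp N (range A)" using * N AB orthogonal_iff by blast
    then show False using N(3) z(1) by (auto simp: perp_def)
  qed
  then show "range A = range B" using grass_eq range_in_grass AB by blast
qed

end

theorem proposition1:
  fixes C :: "('a::chilbert_space \<Rightarrow> 'a) set"
    and f :: "('a \<Rightarrow> 'a) \<Rightarrow> ('a \<Rightarrow> 'a)"
    and k :: nat
  assumes "conjugacy_class C"
    and "\<forall>A\<in>C. crank A = k"
    and "cdim_greater (UNIV :: 'a set) (2 * k)"
    and "bij_betw f C C"
    and "\<forall>A\<in>C. \<forall>B\<in>C. orthogonal_ops A B \<longleftrightarrow> orthogonal_ops (f A) (f B)"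
  shows "\<exists>U. (unitary U \<or> antiunitary U) \<and> (\<forall>A\<in>C. range (f A) = U ` range A)"
proof -
  interpret op_class C k using assms(1,2) by unfold_locales auto
  have f_in: "f A \<in> C" if "A \<in> C" for A using assms(4) that by (auto simp: bij_betw_def)
  have f_surj: "\<exists>A\<in>C. B = f A" if "B \<in> C" for B using assms(4) that by (auto simp: bij_betw_def)
  show ?thesis
  proof (cases "k = 0")
    case True
    \<comment> \<open>In rank 0 every image is the zero subspace, and the identity serves as
      \<open>U\<close>.\<close>
    then have "range A = {0}" if "A \<in> C" for A using range_in_grass[OF that] by (simp add: grass_0)
    then have "\<forall>A\<in>C. range (f A) = id ` range A" using f_in by simp
    then show ?thesis using unitary_id by blast
  next
    case False
    then have k: "1 \<le> k" by simp
    have range_f: "range (f A) = range (f B) \<longleftrightarrow> range A = range B" if AB: "A \<in> C" "B \<in> C" for A B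
    proof -
      \<comment> \<open>\<open>f\<close> maps onto \<open>C\<close>, so it suffices to test against
        members of the form \<open>f D\<close>.\<close>
      have "range (f A) = range (f B) \<longleftrightarrow>
          (\<forall>D\<in>f ` C. orthogonal_ops D (f A) \<longleftrightarrow> orthogonal_ops D (f B))"
        using range_eq_iff[OF assms(3) k f_in f_in, OF AB] assms(4) by (simp add: bij_betw_def)
      also have "\<dots> \<longleftrightarrow> (\<forall>D\<in>C. orthogonal_ops D A \<longleftrightarrow> orthogonal_ops D B)"
        using assms(5) AB by simp
      also have "\<dots> \<longleftrightarrow> range A = range B" using range_eq_iff[OF assms(3) k AB] by simp
      finally show ?thesis .
    qed
    define a where "a X = (SOME A. A \<in> C \<and> range A = X)" for X
    have a: "a X \<in> C" "range (a X) = X" if "X \<in> grass k" for X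
    proof -
      have "\<exists>A. A \<in> C \<and> range A = X" using range_surj[OF that] by metis
      from someI_ex[OF this] show "a X \<in> C" "range (a X) = X" by (auto simp: a_def)
    qed
    \<comment> \<open>The choice of \<open>a X\<close> does not matter: by \<open>range_f\<close>
      the image of \<open>f A\<close> depends only on the image of \<open>A\<close>.\<close>
    define g where "g X = range (f (a X))" for X
    have g: "g (range A) = range (f A)" if "A \<in> C" for A
      using range_f[OF a(1) that] a(2) range_in_grass[OF that] by (auto simp: g_def)
    have "grass_ortho k g"
    proof
      show "bij_betw g (grass k) (grass k)"
      proof (rule bij_betw_imageI[OF inj_onI subset_antisym[OF subsetI subsetI]])
        show "X = Y" if "X \<in> grass k" "Y \<in> grass k" "g X = g Y" for X Y
          using that range_f[OF a(1) a(1)] a(2) by (auto simp: g_def)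
        show "Y \<in> grass k" if "Y \<in> g ` grass k" for Y
          using that a f_in range_in_grass by (auto simp: g_def)
        show "Y \<in> g ` grass k" if Y: "Y \<in> grass k" for Y
        proof -
          obtain A where "A \<in> C" "a Y = f A" using f_surj[OF a(1)[OF Y]] by blast
          then have "Y = g (range A)" "range A \<in> grass k"
            using g a(2)[OF Y] range_in_grass by auto
          then show ?thesis by blast
        qed
      qed
      show "perp (g X) (g Y) \<longleftrightarrow> perp X Y" if "X \<in> grass k" "Y \<in> grass k" for X Y
        using assms(5) a[OF that(1)] a[OF that(2)] f_in
          orthogonal_iff[of "a X" "a Y"] orthogonal_iff[of "f (a X)" "f (a Y)"] by (simp add: g_def)
    qed (use assms(3) k in auto)
    then obtain U where "unitary U \<or> antiunitary U" "\<forall>X\<in>grass k. g X = U ` X"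
      using grass_ortho_induced[OF k] by blast
    then show ?thesis using g range_in_grass by metis
  qed
qed

end
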